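(* Let $F$ be a normed lattice with closed unit ball $B_F$ and universal completion $F^u$. The following conditions are equivalent: (i) $F$ is monotonically complete; (ii) every directed norm bounded dominable subset of $F$ has a supremum in $F$; (iii) $F$ is norm complete and every disjoint $D\subset F_+$ such that $D^{\vee}\subset B_F$ has a supremum in $F$; (iv) the order adherence of $B_F$ in $F^u$ is contained in $F$; (v) every uo-Cauchy net in $B_F$ has a uo-limit in $F$.
   Context: A normed lattice is a real vector lattice with a lattice (solid) norm; norm completeness is not assumed. "Directed" means upward directed. $F$ is monotonically complete if every directed subset of $B_F\cap F_+$ has a supremum in $F$. For $A\subset F$, $A^{\vee}$ is the set of all suprema of nonempty finite subsets of $A$. $Q\downarrow 0$ means that $Q$ is downward directed with infimum $0$. A net $(f_p)$ in a vector lattice $G$ order converges to $f$ if there is $Q\subset G$ with $Q\downarrow 0$ such that for every $q\in Q$ there is $p_q$ with $|f_p-f|\le q$ whenever $p\ge p_q$. It uo converges to $f$ if $|f_p-f|\wedge e$ order converges to $0$ for every $e\in G_+$. A net $(f_p)_{p\in P}$ is uo-Cauchy if the net $(f_p-f_q)_{(p,q)\in P\times P}$ uo converges to $0$. The order adherence of a set in $G$ is the set of all order limits in $G$ of nets of its elements. A sublattice $E$ of $G$ is order dense if for every $0<g\in G$ there is $e\in E$ with $0<e\le g$. The universal completion $F^u$ is the (essentially unique) universally complete vector lattice, i.e. order (Dedekind) complete and such that every disjoint set of positive elements is order bounded, that contains $F$ as an order dense sublattice. A subset of $F$ is dominable if it is order bounded in $F^u$. *)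

theory Defs
  imports "HOL-Analysis.Analysis" "HOL-Library.Lattice_Algebras" "HOL-Library.Lub_Glb"
begin

class vector_lattice = ordered_real_vector + lattice_ab_group_add_abs

class normed_lattice = vector_lattice + real_normed_vector +
  assumes norm_solid: "\<bar>x\<bar> \<le> \<bar>y\<bar> \<Longrightarrow> norm x \<le> norm y"

definition disjoint_set :: "'a::lattice_ab_group_add_abs set \<Rightarrow> bool" where
  "disjoint_set D \<longleftrightarrow> pairwise (\<lambda>x y. inf \<bar>x\<bar> \<bar>y\<bar> = 0) D"

text \<open>
  Directed sets are nonempty. For a set \<open>A\<close> in a lattice, upward directed is
  \<open>directed_by A (\<le>)\<close> and downward directed is \<open>directed_by A (\<ge>)\<close>.
\<close>

definition directed_by :: "'i set \<Rightarrow> ('i \<Rightarrow> 'i \<Rightarrow> bool) \<Rightarrow> bool" where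
  "directed_by P le \<longleftrightarrow> P \<noteq> {} \<and> reflp_on P le \<and> transp_on P le \<and>
     (\<forall>p\<in>P. \<forall>q\<in>P. \<exists>r\<in>P. le p r \<and> le q r)"

definition finite_sups :: "'a::lattice set \<Rightarrow> 'a set" where
  "finite_sups A = {Sup_fin S |S. finite S \<and> S \<noteq> {} \<and> S \<subseteq> A}"

definition monotonically_complete :: "'a::normed_lattice itself \<Rightarrow> bool" where
  "monotonically_complete _ \<longleftrightarrow>
     (\<forall>A::'a set. A \<subseteq> cball 0 1 \<inter> {0..} \<longrightarrow> directed_by A (\<le>) \<longrightarrow> (\<exists>s. isLub UNIV A s))"

definition decreases_to_zero :: "'a::vector_lattice set \<Rightarrow> bool" where
  "decreases_to_zero Q \<longleftrightarrow> directed_by Q (\<ge>) \<and> isGlb UNIV Q 0"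

text \<open>A net is a function on a set \<open>P\<close> that is directed by \<open>le\<close>.\<close>

definition order_converges ::
    "'i set \<Rightarrow> ('i \<Rightarrow> 'i \<Rightarrow> bool) \<Rightarrow> ('i \<Rightarrow> 'a::vector_lattice) \<Rightarrow> 'a \<Rightarrow> bool" where
  "order_converges P le f g \<longleftrightarrow>
     (\<exists>Q. decreases_to_zero Q \<and> (\<forall>q\<in>Q. \<exists>p0\<in>P. \<forall>p\<in>P. le p0 p \<longrightarrow> \<bar>f p - g\<bar> \<le> q))"

definition uo_converges ::
    "'i set \<Rightarrow> ('i \<Rightarrow> 'i \<Rightarrow> bool) \<Rightarrow> ('i \<Rightarrow> 'a::vector_lattice) \<Rightarrow> 'a \<Rightarrow> bool" where
  "uo_converges P le f g \<longleftrightarrow> (\<forall>e\<ge>0. order_converges P le (\<lambda>p. inf \<bar>f p - g\<bar> e) 0)"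

definition uo_Cauchy ::
    "'i set \<Rightarrow> ('i \<Rightarrow> 'i \<Rightarrow> bool) \<Rightarrow> ('i \<Rightarrow> 'a::vector_lattice) \<Rightarrow> bool" where
  "uo_Cauchy P le f \<longleftrightarrow> uo_converges (P \<times> P) (rel_prod le le) (\<lambda>(p, q). f p - f q) 0"

text \<open>
  HOL cannot quantify over types inside a formula, so a statement about all nets in \<open>'g\<close> ranges
  over the index sets in one type. The first summand \<open>'i\<close> is left free, so that a theorem covers
  nets over every index type. The second summand provides enough nets: convergence of a net depends
  only on the filter generated by its tails, and each such filter \<open>\<F>\<close> on \<open>'g\<close> is the tail filter of
  the net \<open>(x, S) \<mapsto> x\<close> on \<open>{(x, S). S \<in> \<F> \<and> x \<in> S}\<close>, ordered by reverse inclusion of \<open>S\<close>.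
\<close>

type_synonym ('i, 'g) net_index = "'i + 'g \<times> 'g set"

definition order_adherence :: "'i itself \<Rightarrow> 'g::vector_lattice set \<Rightarrow> 'g set" where
  "order_adherence _ A = {g. \<exists>(P :: ('i, 'g) net_index set) le f.
     directed_by P le \<and> f ` P \<subseteq> A \<and> order_converges P le f g}"

definition universally_complete :: "'g::vector_lattice itself \<Rightarrow> bool" where
  "universally_complete _ \<longleftrightarrow>
     (\<forall>A::'g set. A \<noteq> {} \<longrightarrow> bdd_above A \<longrightarrow> (\<exists>s. isLub UNIV A s)) \<and>
     (\<forall>D::'g set. D \<subseteq> {0..} \<longrightarrow> disjoint_set D \<longrightarrow> bdd_above D)"

definition order_dense :: "'g::vector_lattice set \<Rightarrow> bool" where
  "order_dense E \<longleftrightarrow> (\<forall>g>0. \<exists>e\<in>E. 0 < e \<and> e \<le> g)"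

text \<open>The universal completion of \<open>'a\<close>, presented as a type with an embedding of \<open>'a\<close>.\<close>

definition universal_completion ::
    "('a::vector_lattice \<Rightarrow> 'u::vector_lattice) \<Rightarrow> bool" where
  "universal_completion j \<longleftrightarrow> universally_complete TYPE('u) \<and> linear j \<and> inj j \<and>
     (\<forall>x y. j (sup x y) = sup (j x) (j y)) \<and> (\<forall>x y. j (inf x y) = inf (j x) (j y)) \<and>
     order_dense (range j)"

definition dominable ::
    "('a::vector_lattice \<Rightarrow> 'u::vector_lattice) \<Rightarrow> 'a set \<Rightarrow> bool" where
  "dominable j A \<longleftrightarrow> bdd_above (j ` A) \<and> bdd_below (j ` A)"

end

theory Submission
  imports Defs
begin

text \<open>
  Every condition other than monotone completeness yields suprema of the directed sets \<open>A\<close> of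
  positive elements of the unit ball that are order bounded in the universal completion. This is
  enough for monotone completeness: if \<open>A\<close> is not dominable, there is \<open>x > 0\<close> such that
  \<open>c x = sup {a \<sqinter> c x | a \<in> A}\<close> for all \<open>c > 0\<close>. No atom lies below such an \<open>x\<close>, so there are disjoint
  \<open>x\<^sub>i\<close> with \<open>0 < x\<^sub>i \<le> x\<close>, and for rapidly growing \<open>c\<^sub>i\<close> the sums of the \<open>2\<^sup>-\<^sup>i (a \<sqinter> c\<^sub>i x\<^sub>i)\<close> form a
  dominable norm bounded directed set without supremum.

  Under (iii), \<open>F\<close> has principal band projections. For \<open>u = sup A\<close> in the universal completion and
  \<open>\<epsilon> > 0\<close>, the projections of suitable \<open>a\<^sub>z \<in> A\<close> onto disjoint principal bands on which
  \<open>u \<le> (1 + \<epsilon>) a\<^sub>z\<close> have a supremum \<open>v\<close> in \<open>F\<close> with \<open>v \<le> u \<le> (1 + \<epsilon>) v\<close>. As \<open>\<epsilon> \<rightarrow> 0\<close> these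
  converge in norm to \<open>u\<close>.

  Under (iv) and (v), \<open>A\<close> itself is a net that converges to \<open>u\<close> and is uo-Cauchy. Conversely,
  monotone completeness provides the limit inferior in \<open>F\<close> of a positive net in the unit ball, and
  this is the limit sought; the general case follows by treating positive and negative parts.
\<close>

declare neg_inf_eq_sup [simp del] neg_sup_eq_inf [simp del]
  diff_inf_eq_sup [simp del] diff_sup_eq_inf [simp del]

section \<open>Vector lattices\<close>

lemma isLub_UNIV_iff:
  "isLub UNIV S x \<longleftrightarrow> (\<forall>y\<in>S. y \<le> x) \<and> (\<forall>b. (\<forall>y\<in>S. y \<le> b) \<longrightarrow> x \<le> b)"
  by (auto simp: isLub_def leastP_def isUb_def setle_def setge_def)

lemma isGlb_UNIV_iff:
  "isGlb UNIV S x \<longleftrightarrow> (\<forall>y\<in>S. x \<le> y) \<and> (\<forall>b. (\<forall>y\<in>S. b \<le> y) \<longrightarrow> b \<le> x)"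
  by (auto simp: isGlb_def greatestP_def isLb_def setle_def setge_def)

lemma isLub_uminus_image:
  fixes S :: "'a::ordered_ab_group_add set"
  shows "isLub UNIV (uminus ` S) (- s) \<longleftrightarrow> isGlb UNIV S s"
proof -
  have "(\<forall>b. (\<forall>y\<in>S. - y \<le> b) \<longrightarrow> - s \<le> b) \<longleftrightarrow> (\<forall>b. (\<forall>y\<in>S. - y \<le> - b) \<longrightarrow> - s \<le> - b)"
    using minus_minus by metis
  then show ?thesis by (simp add: isLub_UNIV_iff isGlb_UNIV_iff)
qed

text \<open>Adding \<open>pprt (- x)\<close> to both sides of \<open>inf x 0 = - pprt (- x)\<close>
  turns the left side into the meet of the two parts.\<close>

lemma inf_pprt_pprt_uminus: "inf (pprt x) (pprt (- x)) = 0"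
  for x :: "'a::lattice_ab_group_add"
proof -
  have "pprt x = x + pprt (- x)"
    using prts[of x] by (simp add: pprt_neg algebra_simps)
  then have "inf (pprt x) (pprt (- x)) = pprt (- x) + inf x 0"
    using add_inf_distrib_left[of "pprt (- x)" x 0] by (simp add: add.commute)
  then show ?thesis
    by (simp add: pprt_neg nprt_def)
qed

lemma inf_pprt_diff: "inf (pprt (x - y)) (pprt (y - x)) = 0"
  for x :: "'a::lattice_ab_group_add"
  using inf_pprt_pprt_uminus[of "x - y"] by simp

lemma le_pprt: "x \<le> pprt x" for x :: "'a::lattice_ab_group_add"
  by (simp add: pprt_def)

lemma pprt_le_iff: "pprt x \<le> y \<longleftrightarrow> x \<le> y \<and> 0 \<le> y" for x :: "'a::lattice_ab_group_add"
  by (simp add: pprt_def)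

lemma pprt_eq_0_iff: "pprt x = 0 \<longleftrightarrow> x \<le> 0" for x :: "'a::lattice_ab_group_add"
  by (simp add: le_zero_iff_zero_pprt)

lemma inf_zero_mono:
  fixes x :: "'a::lattice_ab_group_add"
  assumes "inf x y = 0" "0 \<le> u" "u \<le> x" "0 \<le> v" "v \<le> y"
  shows "inf u v = 0"
  using assms by (metis antisym inf_greatest inf_mono)

text \<open>The left side lies below each of \<open>x + y\<close>, \<open>x + z\<close>,
  \<open>z + y\<close> and \<open>z + z\<close>. Since translations preserve meets, the meet of
  these four is the right side.\<close>

lemma inf_add_le:
  fixes x :: "'a::lattice_ab_group_add"
  assumes "0 \<le> x" "0 \<le> y" "0 \<le> z"
  shows "inf (x + y) z \<le> inf x z + inf y z"
proof -
  have "inf (x + y) z \<le> inf (inf (x + y) (x + z)) (inf (z + y) (z + z))"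
    using assms by (auto intro: le_infI1 le_infI2 add_increasing add_increasing2)
  also have "\<dots> = inf x z + inf y z"
    by (simp add: add_inf_distrib_left add_inf_distrib_right inf_aci)
  finally show ?thesis .
qed

lemma inf_add_eq_0:
  fixes x :: "'a::lattice_ab_group_add"
  assumes "0 \<le> x" "0 \<le> y" "0 \<le> z" "inf x z = 0" "inf y z = 0"
  shows "inf (x + y) z = 0"
  using inf_add_le[OF assms(1-3)] assms by (simp add: antisym)

lemma inf_scaleR_eq_0:
  fixes x :: "'a::vector_lattice"
  assumes "inf x y = 0" "0 \<le> c"
  shows "inf (c *\<^sub>R x) y = 0"
proof -
  \<comment> \<open>Dividing by some \<open>m\<close> that is at least 1 and at least
    \<open>c\<close> brings the meet below both \<open>x\<close> and \<open>y\<close>.\<close>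
  define m where "m = max c 1"
  have m: "m \<ge> 1" "m \<ge> c" by (auto simp: m_def)
  have nn: "0 \<le> x" "0 \<le> y" using assms(1) by (metis inf_le1 inf_le2)+
  have "(1/m) *\<^sub>R inf (c *\<^sub>R x) y \<le> (1/m) *\<^sub>R (c *\<^sub>R x)"
    using m by (intro scaleR_left_mono) auto
  also have "\<dots> \<le> x"
    using m nn scaleR_left_le_one_le[of x "c/m"] by simp
  finally have 1: "(1/m) *\<^sub>R inf (c *\<^sub>R x) y \<le> x" .
  have "(1/m) *\<^sub>R inf (c *\<^sub>R x) y \<le> (1/m) *\<^sub>R y"
    using m by (intro scaleR_left_mono) auto
  also have "\<dots> \<le> y"
    using m nn by (intro scaleR_left_le_one_le) auto
  finally have "(1/m) *\<^sub>R inf (c *\<^sub>R x) y \<le> 0"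
    using 1 assms(1) by (metis inf_greatest)
  then have "inf (c *\<^sub>R x) y \<le> 0"
    using m by (simp add: scaleR_le_0_iff)
  then show ?thesis
    using nn assms by (intro antisym) (auto simp: scaleR_nonneg_nonneg)
qed

lemma scaleR_sup:
  fixes x :: "'a::vector_lattice"
  assumes "0 \<le> c"
  shows "c *\<^sub>R sup x y = sup (c *\<^sub>R x) (c *\<^sub>R y)"
proof (cases "c = 0")
  case False
  with assms have c: "c > 0" by simp
  have "sup x y \<le> (1/c) *\<^sub>R sup (c *\<^sub>R x) (c *\<^sub>R y)"
    using c by (intro sup_least; subst scaleR_le_cancel_left_pos[of c, symmetric]) auto
  then have "c *\<^sub>R sup x y \<le> sup (c *\<^sub>R x) (c *\<^sub>R y)"
    using c by (subst (asm) scaleR_le_cancel_left_pos[of c, symmetric]) auto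
  then show ?thesis
    using c by (intro antisym) (auto intro: scaleR_left_mono)
qed auto

lemma add_eq_sup:
  fixes x :: "'a::lattice_ab_group_add"
  assumes "inf x y = 0"
  shows "x + y = sup x y"
  using add_eq_inf_sup[of x y] assms by simp

text \<open>Finite sums of disjoint positive elements are joins, so a common bound of the terms
  bounds the sum.\<close>

lemma sum_disjoint_le:
  fixes x :: "'i \<Rightarrow> 'a::vector_lattice"
  assumes "finite I" "0 \<le> s" "\<And>i. i \<in> I \<Longrightarrow> 0 \<le> x i \<and> x i \<le> s"
    and "\<And>i k. i \<in> I \<Longrightarrow> k \<in> I \<Longrightarrow> i \<noteq> k \<Longrightarrow> inf (x i) (x k) = 0"
  shows "sum x I \<le> s"
proof -
  have disj: "inf (sum x J) (x k) = 0" if "k \<in> I" "k \<notin> J" "J \<subseteq> I" for J k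
    using finite_subset[OF that(3) assms(1)] that
  proof (induction J)
    case (insert i J)
    then show ?case
      using assms(3,4) by (auto intro!: inf_add_eq_0 sum_nonneg)
  qed (use assms(3)[of k] in \<open>simp add: inf_absorb1\<close>)
  have "sum x J \<le> s" if "J \<subseteq> I" for J
    using finite_subset[OF that assms(1)] that
  proof (induction J)
    case (insert i J)
    have "inf (x i) (sum x J) = 0" using disj[of i J] insert by (simp add: inf_commute)
    then have "sum x (insert i J) = sup (x i) (sum x J)"
      using insert by (simp add: add_eq_sup)
    then show ?case using insert assms(3) by auto
  qed (simp add: assms(2))
  then show ?thesis by simp
qed

text \<open>Each \<open>k\<close> is disjoint from \<open>inf d w\<close>, so
  \<open>k + inf d w\<close> is a join of two elements below \<open>d\<close>. Hence
  \<open>d - inf d w\<close> is still an upper bound of \<open>K\<close>, which forces the overlap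
  to vanish.\<close>

lemma isLub_inf_eq_0:
  fixes d :: "'a::lattice_ab_group_add"
  assumes "isLub UNIV K d" "K \<noteq> {}" "\<And>k. k \<in> K \<Longrightarrow> 0 \<le> k \<and> inf k w = 0" "0 \<le> w"
  shows "inf d w = 0"
proof -
  have ub: "\<And>k. k \<in> K \<Longrightarrow> k \<le> d" and lst: "\<And>b. (\<And>k. k \<in> K \<Longrightarrow> k \<le> b) \<Longrightarrow> d \<le> b"
    using assms(1) by (auto simp: isLub_UNIV_iff)
  have d: "0 \<le> d" using assms(2,3) ub by (meson all_not_in_conv order_trans)
  have "d \<le> d - inf d w"
  proof (rule lst)
    fix k assume k: "k \<in> K"
    have "inf k (inf d w) = 0"
      using assms(3)[OF k] d assms(4) by (metis inf.left_commute inf_absorb2 inf_commute)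
    then have "k + inf d w = sup k (inf d w)" by (rule add_eq_sup)
    also have "\<dots> \<le> d" using ub[OF k] by simp
    finally show "k \<le> d - inf d w" by (simp add: algebra_simps)
  qed
  then show ?thesis using d assms(4) by (simp add: antisym)
qed

text \<open>Replacing \<open>s\<close> by \<open>h\<close> increases the truncated difference by at
  most \<open>s - h\<close>. Therefore \<open>inf (c - h) e - w + h\<close> is a lower bound of
  \<open>S\<close>, hence at most \<open>h\<close>.\<close>

lemma isGlb_inf_diff_le:
  fixes c :: "'a::lattice_ab_group_add"
  assumes "isGlb UNIV S h" "\<And>s. s \<in> S \<Longrightarrow> inf (c - s) e \<le> w"
  shows "inf (c - h) e \<le> w"
proof -
  have "inf (c - h) e - w + h \<le> s" if s: "s \<in> S" for s
  proof -
    have hs: "h \<le> s" using assms(1) s by (auto simp: isGlb_UNIV_iff)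
    have "inf (c - h) e = inf (c - s + (s - h)) e" by simp
    also have "\<dots> \<le> inf (c - s + (s - h)) (e + (s - h))"
      using hs by (intro inf_mono) auto
    also have "\<dots> = inf (c - s) e + (s - h)" by (simp add: add_inf_distrib_right)
    also have "\<dots> \<le> w + (s - h)" using assms(2)[OF s] by simp
    finally show ?thesis by (simp add: algebra_simps)
  qed
  then have "inf (c - h) e - w + h \<le> h"
    using assms(1) unfolding isGlb_UNIV_iff by blast
  then show ?thesis by (simp add: algebra_simps)
qed

lemma isLub_inf_diff_le:
  fixes c :: "'a::lattice_ab_group_add"
  assumes "isLub UNIV S h" "\<And>s. s \<in> S \<Longrightarrow> inf (s - c) e \<le> w"
  shows "inf (h - c) e \<le> w"
proof -
  have "isGlb UNIV (uminus ` S) (- h)"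
    using assms(1) isLub_uminus_image[of "uminus ` S" "- h"] by (simp add: image_image)
  moreover have "inf (- c - s) e \<le> w" if "s \<in> uminus ` S" for s
    using that assms(2) by auto
  ultimately show ?thesis
    using isGlb_inf_diff_le[of "uminus ` S" "- h" "- c" e w] by simp
qed

text \<open>The absolute value is the join of the disjoint elements \<open>pprt x\<close> and
  \<open>pprt (- x)\<close>, so it is enough to bound the truncation of each.\<close>

lemma inf_abs_le_iff:
  fixes x :: "'a::lattice_ab_group_add_abs"
  assumes "0 \<le> e" "0 \<le> w"
  shows "inf \<bar>x\<bar> e \<le> w \<longleftrightarrow> inf x e \<le> w \<and> inf (- x) e \<le> w"
proof
  assume "inf \<bar>x\<bar> e \<le> w"
  then show "inf x e \<le> w \<and> inf (- x) e \<le> w"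
    by (meson abs_ge_minus_self abs_ge_self inf_mono order_refl order_trans)
next
  assume *: "inf x e \<le> w \<and> inf (- x) e \<le> w"
  \<comment> \<open>The excess \<open>inf (pprt y) e - w\<close> is shown to lie below both
    \<open>pprt y\<close> and \<open>pprt (- y)\<close>, whose meet is 0.\<close>
  have pos: "inf (pprt y) e \<le> w" if "inf y e \<le> w" for y
  proof -
    have "inf (pprt y) e - pprt (-y) \<le> inf y e"
    proof (rule inf_greatest)
      have "inf (pprt y) e - pprt (- y) \<le> pprt y - pprt (- y)" by (intro diff_right_mono) simp
      then show "inf (pprt y) e - pprt (- y) \<le> y" using prts[of y] by (simp add: pprt_neg)
      show "inf (pprt y) e - pprt (- y) \<le> e" by (simp add: diff_le_eq add_increasing2)
    qed
    then have 1: "inf (pprt y) e - w \<le> pprt (- y)"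
      using that by (metis diff_le_eq order_trans add.commute)
    have "inf (pprt y) e - w \<le> pprt y"
      using assms by (simp add: diff_le_eq add_increasing2 le_infI1)
    then have "inf (pprt y) e - w \<le> inf (pprt y) (pprt (- y))" using 1 by simp
    then show ?thesis by (simp add: inf_pprt_pprt_uminus)
  qed
  have "inf \<bar>x\<bar> e = inf (pprt x + pprt (- x)) e" by (simp add: abs_prts pprt_neg)
  also have "\<dots> \<le> inf (pprt x) e + inf (pprt (- x)) e"
    using assms by (intro inf_add_le) auto
  also have "\<dots> = sup (inf (pprt x) e) (inf (pprt (- x)) e)"
    using assms by (intro add_eq_sup inf_zero_mono[OF inf_pprt_pprt_uminus[of x]]) auto
  finally show "inf \<bar>x\<bar> e \<le> w" using pos * by (meson order_trans sup_least)
qed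

lemma isLub_scaleR:
  fixes S :: "'a::vector_lattice set"
  assumes "0 < c"
  shows "isLub UNIV ((*\<^sub>R) c ` S) s \<longleftrightarrow> isLub UNIV S (s /\<^sub>R c)"
proof -
  have 1: "c *\<^sub>R x \<le> b \<longleftrightarrow> x \<le> b /\<^sub>R c" for x b :: 'a
    using assms by (simp add: pos_le_divideR_eq)
  have 2: "s \<le> b \<longleftrightarrow> s /\<^sub>R c \<le> b /\<^sub>R c" for b
    using assms scaleR_le_cancel_left_pos[of "inverse c" s b] by simp
  have "(\<forall>b. (\<forall>y\<in>S. y \<le> b /\<^sub>R c) \<longrightarrow> s /\<^sub>R c \<le> b /\<^sub>R c) \<longleftrightarrow>
        (\<forall>b. (\<forall>y\<in>S. y \<le> b) \<longrightarrow> s /\<^sub>R c \<le> b)"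
  proof
    assume *: "\<forall>b. (\<forall>y\<in>S. y \<le> b /\<^sub>R c) \<longrightarrow> s /\<^sub>R c \<le> b /\<^sub>R c"
    show "\<forall>b. (\<forall>y\<in>S. y \<le> b) \<longrightarrow> s /\<^sub>R c \<le> b"
    proof
      fix b
      show "(\<forall>y\<in>S. y \<le> b) \<longrightarrow> s /\<^sub>R c \<le> b"
        using *[rule_format, of "c *\<^sub>R b"] assms by simp
    qed
  qed blast
  then show ?thesis
    unfolding isLub_UNIV_iff by (simp add: 1 2)
qed

lemma isLub_plus:
  fixes S :: "'a::ordered_ab_group_add set"
  shows "isLub UNIV ((+) c ` S) (c + s) \<longleftrightarrow> isLub UNIV S s"
proof -
  have 1: "c + x \<le> b \<longleftrightarrow> x \<le> b - c" for x b :: 'a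
    by (simp add: algebra_simps)
  have "(\<forall>b. (\<forall>y\<in>S. y \<le> b - c) \<longrightarrow> s \<le> b - c) \<longleftrightarrow> (\<forall>b. (\<forall>y\<in>S. y \<le> b) \<longrightarrow> s \<le> b)"
    by (metis add_diff_cancel)
  then show ?thesis
    unfolding isLub_UNIV_iff by (simp add: 1)
qed

section \<open>Solid norms, the Archimedean property and rescaling into the unit ball\<close>

lemma norm_mono:
  fixes x :: "'a::normed_lattice"
  assumes "0 \<le> x" "x \<le> y"
  shows "norm x \<le> norm y"
  using assms by (intro norm_solid) (metis abs_of_nonneg order_trans)

lemma norm_pprt_le: "norm (pprt x) \<le> norm x" for x :: "'a::normed_lattice"
  by (rule norm_solid) (simp add: abs_prts)

text \<open>By solidity all multiples of \<open>y\<close> have norm at most \<open>norm x\<close>,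
  and the real numbers are Archimedean.\<close>

lemma archimedean_normed_lattice:
  fixes x :: "'a::normed_lattice"
  assumes "0 \<le> y" "\<And>n::nat. real n *\<^sub>R y \<le> x"
  shows "y = 0"
proof (rule ccontr)
  assume "y \<noteq> 0"
  obtain n :: nat where n: "norm x / norm y < real n" using reals_Archimedean2 by blast
  have "norm (real n *\<^sub>R y) \<le> norm x"
    using assms by (intro norm_mono scaleR_nonneg_nonneg) auto
  then show False using n \<open>y \<noteq> 0\<close> by (simp add: field_simps)
qed

lemma isLub_of_bounded_directed:
  fixes A :: "'a::normed_lattice set"
  assumes mc: "monotonically_complete TYPE('a)"
    and A: "directed_by A (\<le>)" "A \<subseteq> {0..}" "\<And>a. a \<in> A \<Longrightarrow> norm a \<le> C"
  shows "\<exists>s. isLub UNIV A s"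
proof -
  \<comment> \<open>Adding 1 avoids division by 0 when \<open>C = 0\<close>, and scaling by
    \<open>c\<close> still moves the set into the unit ball.\<close>
  define c where "c = 1 / (\<bar>C\<bar> + 1)"
  have c: "c > 0" by (simp add: c_def)
  have "(*\<^sub>R) c ` A \<subseteq> cball 0 1 \<inter> {0..}"
  proof safe
    fix a assume a: "a \<in> A"
    have "norm (c *\<^sub>R a) = norm a / (\<bar>C\<bar> + 1)" by (simp add: c_def)
    also have "\<dots> \<le> 1" using A(3)[OF a] by (subst divide_le_eq) auto
    finally show "c *\<^sub>R a \<in> cball 0 1" by simp
    show "0 \<le> c *\<^sub>R a" using a A(2) c by (intro scaleR_nonneg_nonneg) auto
  qed
  moreover have "directed_by ((*\<^sub>R) c ` A) (\<le>)"
  proof -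
    have "\<exists>r\<in>A. c *\<^sub>R p \<le> c *\<^sub>R r \<and> c *\<^sub>R q \<le> c *\<^sub>R r" if "p \<in> A" "q \<in> A" for p q
      using A(1) that c unfolding directed_by_def by (metis scaleR_le_cancel_left_pos)
    then show ?thesis
      using A(1) by (auto simp: directed_by_def intro!: reflp_onI transp_onI)
  qed
  ultimately obtain s where "isLub UNIV ((*\<^sub>R) c ` A) s"
    using mc unfolding monotonically_complete_def by blast
  then show ?thesis using isLub_scaleR[OF c] by blast
qed

section \<open>Maximal disjoint sets and band projections\<close>

text \<open>\<open>d\<close> is the component of the positive \<open>x\<close> in the band generated
  by \<open>z\<close>: the remainder lies in the disjoint complement of \<open>z\<close>, and
  \<open>d\<close> in its double disjoint complement. A relation is used because the component need
  not exist in a general vector lattice.\<close>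

definition is_band_projection :: "'a::lattice_ab_group_add \<Rightarrow> 'a \<Rightarrow> 'a \<Rightarrow> bool" where
  "is_band_projection z x d \<longleftrightarrow>
     0 \<le> d \<and> d \<le> x \<and> inf (x - d) z = 0 \<and> (\<forall>w\<ge>0. inf z w = 0 \<longrightarrow> inf d w = 0)"

lemma is_band_projection_disjoint:
  assumes "is_band_projection z x d" "is_band_projection z' x' d'" "inf z z' = 0"
  shows "inf d d' = 0"
proof -
  have disj: "inf d w = 0" if "0 \<le> w" "inf z w = 0" for w
    using assms(1) that unfolding is_band_projection_def by blast
  have disj': "inf d' w = 0" if "0 \<le> w" "inf z' w = 0" for w
    using assms(2) that unfolding is_band_projection_def by blast
  have "0 \<le> z'" using inf_le2[of z z'] assms(3) by simp
  then have "inf z' d = 0" using disj assms(3) inf_commute[of z' d] by simp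
  moreover have "0 \<le> d" using assms(1) unfolding is_band_projection_def by blast
  ultimately show ?thesis using disj'[of d] inf_commute[of d d'] by simp
qed

text \<open>The relation \<open>inf (pprt (x - y)) z = 0\<close> means that \<open>x \<le> y\<close>
  holds on the band of \<open>z\<close>. Here \<open>x \<le> b = d \<le> v\<close> on that band: the
  excess of \<open>x\<close> over \<open>v\<close> is at most \<open>pprt (x - b) + (b - d)\<close>,
  a sum of two elements disjoint from \<open>z\<close>.\<close>

lemma inf_pprt_diff_eq_0:
  fixes x :: "'a::lattice_ab_group_add"
  assumes "inf (pprt (x - b)) z = 0" "inf (b - d) z = 0" "d \<le> v"
  shows "inf (pprt (x - v)) z = 0"
proof -
  have z: "0 \<le> z" "0 \<le> b - d" using assms by (metis inf_le2, metis inf_le1)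
  have *: "inf (pprt (x - b) + (b - d)) z = 0"
    using assms z by (intro inf_add_eq_0) auto
  have "pprt (x - v) \<le> pprt (x - b) + (b - d)"
  proof -
    have "x - v \<le> x - d" using assms by (simp add: diff_left_mono)
    also have "\<dots> = (x - b) + (b - d)" by simp
    also have "\<dots> \<le> pprt (x - b) + (b - d)" by (intro add_right_mono le_pprt)
    finally show ?thesis using z(2) by (simp add: pprt_le_iff)
  qed
  then show ?thesis using z by (intro inf_zero_mono[OF *]) auto
qed

text \<open>Order completeness provides the supremum of the elements \<open>inf (n z) x\<close>,
  which is the classical formula for the projection.\<close>

lemma ex_band_projection:
  fixes z :: "'u::vector_lattice"
  assumes uc: "universally_complete TYPE('u)" and z: "0 \<le> z" and x: "0 \<le> x"
  shows "\<exists>d. is_band_projection z x d"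
proof -
  define K where "K = range (\<lambda>n::nat. inf (real n *\<^sub>R z) x)"
  have "bdd_above K" by (rule bdd_aboveI[of _ x]) (auto simp: K_def)
  moreover have "K \<noteq> {}" by (auto simp: K_def)
  ultimately obtain d where d: "isLub UNIV K d"
    using uc unfolding universally_complete_def by blast
  have ub: "inf (real n *\<^sub>R z) x \<le> d" for n :: nat
    using d by (auto simp: isLub_UNIV_iff K_def)
  have lst: "d \<le> b" if "\<And>n::nat. inf (real n *\<^sub>R z) x \<le> b" for b
    using d that by (auto simp: isLub_UNIV_iff K_def)
  have nn: "0 \<le> inf (real n *\<^sub>R z) x" for n using z x by (simp add: scaleR_nonneg_nonneg)
  have d0: "0 \<le> d" using nn ub order_trans by blast
  have dx: "d \<le> x" by (rule lst) simp
  \<comment> \<open>Adding the overlap \<open>inf (x - d) z\<close> to the \<open>n\<close>-th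
    truncation gives an element below the next truncation, hence below \<open>d\<close>.\<close>
  have "d \<le> d - inf (x - d) z"
  proof (rule lst)
    fix n :: nat
    have "inf (real n *\<^sub>R z) x + inf (x - d) z \<le> real n *\<^sub>R z + z"
      by (intro add_mono) auto
    moreover have "inf (real n *\<^sub>R z) x + inf (x - d) z \<le> d + (x - d)"
      by (intro add_mono ub) simp
    ultimately have "inf (real n *\<^sub>R z) x + inf (x - d) z \<le> inf (real (Suc n) *\<^sub>R z) x"
      by (simp add: scaleR_add_left add.commute)
    also have "\<dots> \<le> d" by (rule ub)
    finally show "inf (real n *\<^sub>R z) x \<le> d - inf (x - d) z" by (simp add: algebra_simps)
  qed
  then have "inf (x - d) z = 0" using dx z by (simp add: antisym)
  moreover have "inf d w = 0" if "0 \<le> w" "inf z w = 0" for w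
  proof (rule isLub_inf_eq_0[OF d])
    fix k assume "k \<in> K"
    then obtain n where "k = inf (real n *\<^sub>R z) x" by (auto simp: K_def)
    then show "0 \<le> k \<and> inf k w = 0"
      using nn that inf_zero_mono[OF inf_scaleR_eq_0[OF that(2), of "real n"], of k w] by auto
  qed (use that in \<open>auto simp: K_def\<close>)
  ultimately show ?thesis using d0 dx unfolding is_band_projection_def by blast
qed

text \<open>Zorn's lemma for disjoint sets of positive elements with property \<open>R\<close>. A
  \<open>y\<close> violating the last clause could be adjoined to a maximal set.\<close>

lemma ex_maximal_disjoint:
  fixes R :: "'a::lattice_ab_group_add \<Rightarrow> bool"
  shows "\<exists>Z. (\<forall>z\<in>Z. 0 < z \<and> R z) \<and> pairwise (\<lambda>x y. inf x y = 0) Z \<and>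
    (\<forall>y>0. R y \<longrightarrow> (\<exists>z\<in>Z. inf y z \<noteq> 0))"
proof -
  define \<Z> where "\<Z> = {Z. (\<forall>z\<in>Z. 0 < z \<and> R z) \<and> pairwise (\<lambda>x y. inf x y = 0) Z}"
  have "\<exists>M\<in>\<Z>. \<forall>X\<in>\<Z>. M \<subseteq> X \<longrightarrow> X = M"
  proof (rule subset_Zorn')
    fix C assume C: "subset.chain \<Z> C"
    have CZ: "C \<subseteq> \<Z>" and lin: "\<And>X Y. X \<in> C \<Longrightarrow> Y \<in> C \<Longrightarrow> X \<subseteq> Y \<or> Y \<subseteq> X"
      using C by (auto simp: subset_chain_def)
    have "inf x y = 0" if xy: "x \<in> \<Union>C" "y \<in> \<Union>C" "x \<noteq> y" for x y
    proof -
      obtain X Y where "x \<in> X" "X \<in> C" "y \<in> Y" "Y \<in> C" using xy by blast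
      then obtain W where "W \<in> C" "x \<in> W" "y \<in> W" using lin by blast
      then show ?thesis using CZ xy by (auto simp: \<Z>_def pairwise_def)
    qed
    then show "\<Union>C \<in> \<Z>" using CZ by (auto simp: \<Z>_def pairwise_def)
  qed
  then obtain M where M: "M \<in> \<Z>" "\<And>X. X \<in> \<Z> \<Longrightarrow> M \<subseteq> X \<Longrightarrow> X = M" by blast
  have "\<exists>z\<in>M. inf y z \<noteq> 0" if y: "0 < y" "R y" for y
  proof (rule ccontr)
    assume "\<not> ?thesis"
    then have *: "\<forall>z\<in>M. inf y z = 0" by blast
    have "insert y M \<in> \<Z>"
      using M(1) y * by (auto simp: \<Z>_def pairwise_def inf_commute)
    then have "y \<in> M" using M(2) by blast
    then show False using * y by auto
  qed
  then show ?thesis using M(1) unfolding \<Z>_def by blast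
qed

section \<open>The embedding into the universal completion\<close>

locale universal_completion_embedding =
  fixes j :: "'a::normed_lattice \<Rightarrow> 'u::vector_lattice"
  assumes universal_completion: "universal_completion j"
begin

lemma
  shows universally_complete: "universally_complete TYPE('u)"
    and linear: "linear j" and inj: "inj j"
    and j_sup: "j (sup x y) = sup (j x) (j y)"
    and j_inf: "j (inf x y) = inf (j x) (j y)"
  using universal_completion by (auto simp: universal_completion_def)

lemma j_simps [simp]:
  "j (x + y) = j x + j y" "j (x - y) = j x - j y" "j (- x) = - j x" "j 0 = 0"
  "j (c *\<^sub>R x) = c *\<^sub>R j x"
  using linear by (simp_all add: linear_add linear_diff linear_neg linear_0 linear_cmul)

lemma j_pprt: "j (pprt x) = pprt (j x)"
  by (simp add: pprt_def j_sup)

lemma j_abs: "j \<bar>x\<bar> = \<bar>j x\<bar>"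
  by (simp add: abs_lattice j_sup)

lemma j_eq_iff [simp]: "j x = j y \<longleftrightarrow> x = y"
  using inj by (simp add: inj_eq)

lemma j_le_iff [simp]: "j x \<le> j y \<longleftrightarrow> x \<le> y"
  unfolding le_iff_inf by (simp flip: j_inf)

lemma j_nonneg_iff [simp]: "0 \<le> j x \<longleftrightarrow> 0 \<le> x"
  using j_le_iff[of 0 x] by simp

lemma j_nonpos_iff [simp]: "j x \<le> 0 \<longleftrightarrow> x \<le> 0"
  using j_le_iff[of x 0] by simp

lemma order_dense_range:
  assumes "0 < g"
  obtains x where "0 < x" "j x \<le> g"
proof -
  obtain x where "0 < j x" "j x \<le> g"
    using universal_completion assms by (auto simp: universal_completion_def order_dense_def)
  then show thesis using that by (simp add: less_le_not_le)
qed

text \<open>Order density makes the embedding preserve suprema: if an upper bound \<open>g\<close>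
  of the images were not above \<open>j s\<close>, some \<open>j y\<close> with \<open>y > 0\<close>
  would lie below \<open>pprt (j s - g)\<close>, and \<open>s - y\<close> would be a smaller upper
  bound of \<open>E\<close>.\<close>

lemma isLub_image:
  assumes "isLub UNIV E s"
  shows "isLub UNIV (j ` E) (j s)"
proof -
  have ub: "\<And>e. e \<in> E \<Longrightarrow> e \<le> s" and lst: "\<And>b. (\<And>e. e \<in> E \<Longrightarrow> e \<le> b) \<Longrightarrow> s \<le> b"
    using assms by (auto simp: isLub_UNIV_iff)
  have "j s \<le> g" if g: "\<And>e. e \<in> E \<Longrightarrow> j e \<le> g" for g
  proof (rule ccontr)
    assume "\<not> j s \<le> g"
    then have "0 < pprt (j s - g)"
      using pprt_eq_0_iff[of "j s - g"] zero_le_pprt[of "j s - g"] by (auto simp: less_le)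
    then obtain y where y: "0 < y" "j y \<le> pprt (j s - g)" by (rule order_dense_range)
    have "s \<le> s - y"
    proof (rule lst)
      fix e assume e: "e \<in> E"
      have "pprt (j s - g) \<le> j s - j e"
        using g[OF e] ub[OF e] by (auto simp: pprt_le_iff intro: diff_left_mono)
      then have "j y \<le> j (s - e)" using y(2) by simp
      then show "e \<le> s - y" by (simp only: j_le_iff) (simp add: algebra_simps)
    qed
    then show False using y by (simp add: less_le_not_le)
  qed
  then show ?thesis using ub by (auto simp: isLub_UNIV_iff)
qed

lemma isGlb_image:
  assumes "isGlb UNIV E s"
  shows "isGlb UNIV (j ` E) (j s)"
proof -
  have "isLub UNIV (j ` uminus ` E) (j (- s))"
    using assms by (intro isLub_image) (simp add: isLub_uminus_image)
  also have "j ` uminus ` E = uminus ` j ` E" by (simp add: image_image)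
  finally show ?thesis by (simp add: isLub_uminus_image)
qed

text \<open>A maximal disjoint set of elements with \<open>R\<close> leaves no room in the universal
  completion. A nonzero \<open>w\<close> disjoint from its images would dominate some
  \<open>j y\<close> with \<open>R y\<close>, and that \<open>y\<close> would be disjoint from the
  whole set. The predicate \<open>H\<close> delimits the elements for which the density hypothesis
  is available.\<close>

lemma ex_exhausting_disjoint:
  assumes "\<And>g. 0 < g \<Longrightarrow> H g \<Longrightarrow> \<exists>y>0. R y \<and> j y \<le> g"
  shows "\<exists>Z. (\<forall>z\<in>Z. 0 < z \<and> R z) \<and> pairwise (\<lambda>x y. inf x y = 0) Z \<and>
    (\<forall>w\<ge>0. H w \<longrightarrow> (\<forall>z\<in>Z. inf w (j z) = 0) \<longrightarrow> w = 0)"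
proof -
  obtain Z where Z: "\<forall>z\<in>Z. 0 < z \<and> R z" "pairwise (\<lambda>x y. inf x y = 0) Z"
    "\<forall>y>0. R y \<longrightarrow> (\<exists>z\<in>Z. inf y z \<noteq> 0)"
    using ex_maximal_disjoint[of R] by blast
  have "w = 0" if w: "0 \<le> w" "H w" "\<And>z. z \<in> Z \<Longrightarrow> inf w (j z) = 0" for w
  proof (rule ccontr)
    assume "w \<noteq> 0"
    then obtain y where y: "0 < y" "R y" "j y \<le> w" using assms[of w] w(1,2) by (auto simp: less_le)
    then obtain z where z: "z \<in> Z" "inf y z \<noteq> 0" using Z(3) by blast
    have "0 < z" using Z(1) z(1) by blast
    have "0 \<le> j y" "0 \<le> j z"
      using less_imp_le[OF \<open>0 < z\<close>] less_imp_le[OF y(1)] by simp_all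
    then have "inf (j y) (j z) = 0"
      by (intro inf_zero_mono[OF w(3)[OF z(1)]] y(3) order_refl)
    then show False using z(2) j_inf[of y z] j_eq_iff[of "inf y z" 0] by simp
  qed
  then show ?thesis by (intro exI[of _ Z] conjI Z(1,2)) auto
qed

text \<open>If no such \<open>x\<close> exists, \<open>A\<close> is bounded on the bands of
  sufficiently many elements. Projecting these local bounds onto the bands of a maximal disjoint
  family gives a disjoint set, which universal completeness bounds, and its bound dominates all of
  \<open>j a\<close>.\<close>

lemma bdd_above_or_unbounded_below:
  assumes A: "A \<subseteq> {0..}" "A \<noteq> {}" and nb: "\<not> bdd_above (j ` A)"
  shows "\<exists>x>0. \<forall>c. isGlb UNIV ((\<lambda>a. pprt (c *\<^sub>R x - a)) ` A) 0"
proof (rule ccontr)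
  assume "\<not> ?thesis"
  then have *: "\<exists>c. \<not> isGlb UNIV ((\<lambda>a. pprt (c *\<^sub>R x - a)) ` A) 0" if "0 < x" for x
    using that by blast
  \<comment> \<open>\<open>R z\<close> says that \<open>A\<close> has a common upper bound
    \<open>b\<close> on the band of \<open>z\<close>.\<close>
  define R where "R = (\<lambda>z. \<exists>b\<ge>0. \<forall>a\<in>A. inf (pprt (a - b)) z = 0)"
  have dense: "\<exists>y>0. R y \<and> j y \<le> g" if "0 < g" for g
  proof -
    obtain x where x: "0 < x" "j x \<le> g" using \<open>0 < g\<close> by (rule order_dense_range)
    \<comment> \<open>The positive part of \<open>l\<close> lies below every
      \<open>pprt (c x - a)\<close> and is therefore disjoint from every
      \<open>pprt (a - c x)\<close>. On its band \<open>c x\<close> bounds \<open>A\<close>, and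
      dividing it by \<open>c\<close> brings it below \<open>x\<close>.\<close>
    obtain c l where l: "\<And>a. a \<in> A \<Longrightarrow> l \<le> pprt (c *\<^sub>R x - a)" "\<not> l \<le> 0"
      using *[OF x(1)] unfolding isGlb_UNIV_iff by auto
    have y: "0 < pprt l" using l(2) pprt_eq_0_iff[of l] zero_le_pprt[of l] by (auto simp: less_le)
    have ya: "pprt l \<le> pprt (c *\<^sub>R x - a)" if "a \<in> A" for a
      using l(1)[OF that] by (simp add: pprt_le_iff)
    obtain a where a: "a \<in> A" using A(2) by blast
    have ycx: "pprt l \<le> pprt (c *\<^sub>R x)"
    proof -
      have "c *\<^sub>R x - a \<le> c *\<^sub>R x" using a A(1) by auto
      then show ?thesis using ya[OF a] pprt_mono order_trans by blast
    qed
    have c: "c > 0"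
    proof (rule ccontr)
      assume "\<not> c > 0"
      then have "pprt (c *\<^sub>R x) = 0" using x by (auto simp: pprt_eq_0_iff intro!: scaleR_nonpos_nonneg)
      then show False using ycx y by (simp add: less_le_not_le)
    qed
    have cx: "0 \<le> c *\<^sub>R x" using c x by (intro scaleR_nonneg_nonneg) auto
    have "inf (pprt l /\<^sub>R c) (pprt (a - c *\<^sub>R x)) = 0" if "a \<in> A" for a
      using c inf_zero_mono[OF inf_pprt_diff[of "c *\<^sub>R x" a] zero_le_pprt ya[OF that], of "pprt (a - c *\<^sub>R x)"]
      by (intro inf_scaleR_eq_0) auto
    then have "R (pprt l /\<^sub>R c)" using cx unfolding R_def by (metis inf_commute)
    moreover have "pprt l /\<^sub>R c \<le> x" using ycx c cx by (simp add: pos_divideR_le_eq)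
    moreover have "0 < pprt l /\<^sub>R c" using y c by (simp add: less_le scaleR_nonneg_nonneg)
    ultimately show ?thesis using x(2) j_le_iff order_trans by blast
  qed
  obtain Z where Z: "\<forall>z\<in>Z. 0 < z \<and> R z" "pairwise (\<lambda>x y. inf x y = 0) Z"
    "\<forall>w\<ge>0. True \<longrightarrow> (\<forall>z\<in>Z. inf w (j z) = 0) \<longrightarrow> w = 0"
    using ex_exhausting_disjoint[of "\<lambda>_. True" R, OF dense] by blast
  have "\<forall>z\<in>Z. \<exists>b\<ge>0. \<forall>a\<in>A. inf (pprt (a - b)) z = 0" using Z(1) unfolding R_def by blast
  then obtain b where b: "\<And>z. z \<in> Z \<Longrightarrow> 0 \<le> b z" "\<And>z a. z \<in> Z \<Longrightarrow> a \<in> A \<Longrightarrow> inf (pprt (a - b z)) z = 0"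
    by metis
  have "\<exists>d. is_band_projection (j z) (j (b z)) d" if "z \<in> Z" for z
    using bspec[OF Z(1) that] b(1)[OF that] by (intro ex_band_projection universally_complete) auto
  then obtain d where d: "\<And>z. z \<in> Z \<Longrightarrow> is_band_projection (j z) (j (b z)) (d z)" by metis
  have "disjoint_set (d ` Z)"
    unfolding disjoint_set_def
  proof (rule pairwise_imageI)
    fix z z' assume "z \<in> Z" "z' \<in> Z" "z \<noteq> z'"
    then show "inf \<bar>d z\<bar> \<bar>d z'\<bar> = 0"
      using is_band_projection_disjoint[OF d[of z] d[of z']] d[of z] d[of z'] pairwiseD[OF Z(2), of z z'] j_inf[of z z']
      by (simp add: is_band_projection_def)
  qed
  moreover have "d ` Z \<subseteq> {0..}" using d by (auto simp: is_band_projection_def)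
  ultimately have "bdd_above (d ` Z)"
    using universally_complete unfolding universally_complete_def by simp
  then obtain M where M: "\<And>z. z \<in> Z \<Longrightarrow> d z \<le> M" by (auto simp: bdd_above_def)
  have "j a \<le> M" if a: "a \<in> A" for a
  proof -
    \<comment> \<open>On the band of each \<open>z\<close> the chain
      \<open>j a \<le> j (b z) = d z \<le> M\<close> holds, and the family \<open>Z\<close> is
      exhausting.\<close>
    have "pprt (j a - M) = 0"
    proof (rule Z(3)[rule_format])
      fix z assume z: "z \<in> Z"
      show "inf (pprt (j a - M)) (j z) = 0"
      proof (rule inf_pprt_diff_eq_0)
        show "inf (pprt (j a - j (b z))) (j z) = 0"
          using b(2)[OF z a] by (simp flip: j_pprt j_inf j_simps(2))
        show "inf (j (b z) - d z) (j z) = 0" using d[OF z] by (simp add: is_band_projection_def)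
        show "d z \<le> M" using M[OF z] .
      qed
    qed simp_all
    then show ?thesis by (simp add: pprt_eq_0_iff)
  qed
  then show False using nb by (auto simp: bdd_above_def)
qed

end

section \<open>Unbounded directed sets\<close>

text \<open>Equivalently, \<open>c x\<close> is the supremum of \<open>{a \<sqinter> c x | a \<in> A}\<close> for every \<open>c > 0\<close>.\<close>

definition vanishing_below :: "'a::vector_lattice set \<Rightarrow> 'a \<Rightarrow> bool" where
  "vanishing_below A x \<longleftrightarrow> (\<forall>c>0. \<forall>l. (\<forall>a\<in>A. l \<le> pprt (c *\<^sub>R x - a)) \<longrightarrow> l \<le> 0)"

lemma vanishing_below_mono:
  assumes "vanishing_below A x" "y \<le> x"
  shows "vanishing_below A y"
  unfolding vanishing_below_def
proof (intro allI impI)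
  fix c :: real and l assume c: "0 < c" and l: "\<forall>a\<in>A. l \<le> pprt (c *\<^sub>R y - a)"
  have "l \<le> pprt (c *\<^sub>R x - a)" if "a \<in> A" for a
  proof -
    have "c *\<^sub>R y \<le> c *\<^sub>R x" using c assms(2) by (intro scaleR_left_mono) auto
    then have "pprt (c *\<^sub>R y - a) \<le> pprt (c *\<^sub>R x - a)" by (intro pprt_mono diff_right_mono)
    with l that show ?thesis by (meson order_trans)
  qed
  with assms(1) c show "l \<le> 0" unfolding vanishing_below_def by simp
qed

text \<open>If \<open>y\<close> were an atom, some \<open>a \<in> A\<close> would dominate a multiple of \<open>y\<close> whose norm exceeds 1.\<close>

lemma vanishing_below_split:
  fixes y :: "'a::normed_lattice"
  assumes A: "A \<subseteq> cball 0 1 \<inter> {0..}" and y: "0 < y" and van: "vanishing_below A y"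
  shows "\<exists>p q. 0 < p \<and> 0 < q \<and> p \<le> y \<and> q \<le> y \<and> inf p q = 0"
proof (rule ccontr)
  assume none: "\<not> ?thesis"
  \<comment> \<open>The norm of \<open>b\<close> becomes 2, so that \<open>b \<le> a\<close> is
    impossible for \<open>a\<close> in the unit ball.\<close>
  define c where "c = 2 / norm y"
  have c: "c > 0" using y by (auto simp: c_def)
  define b where "b = c *\<^sub>R y"
  have nb: "norm b = 2" using y by (auto simp: b_def c_def)
  have b0: "0 \<le> b" using c y by (simp add: b_def scaleR_nonneg_nonneg less_imp_le)
  \<comment> \<open>\<open>b\<close> turns out to be a lower bound of the differences at scale
    \<open>2 * c\<close>, so \<open>van\<close> forces it to be 0.\<close>
  have "b \<le> pprt ((2 * c) *\<^sub>R y - a)" if a: "a \<in> A" for a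
  proof -
    have a0: "0 \<le> a" and na: "norm a \<le> 1" using A a by auto
    define p where "p = inf (pprt (a - b)) y"
    define q where "q = inf (pprt (b - a)) y"
    have pq: "0 \<le> p" "0 \<le> q" using y by (auto simp: p_def q_def less_imp_le)
    have "inf p q = 0"
      by (rule inf_zero_mono[OF inf_pprt_diff[of a b] pq(1) _ pq(2)]) (auto simp: p_def q_def)
    moreover have "p \<le> y" "q \<le> y" by (simp_all add: p_def q_def)
    \<comment> \<open>Since \<open>y\<close> dominates no disjoint pair, either
      \<open>a \<le> b\<close> or \<open>b \<le> a\<close> must hold on the band of
      \<open>y\<close>. The norms exclude the latter.\<close>
    ultimately have "p = 0 \<or> q = 0" using none pq by (auto simp: less_le)
    moreover have "q \<noteq> 0"
    proof
      assume "q = 0"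
      then have "inf b (pprt (b - a)) = 0"
        unfolding b_def q_def using c by (intro inf_scaleR_eq_0) (auto simp: inf_commute)
      moreover have "pprt (b - a) \<le> b" using a0 b0 by (simp add: pprt_le_iff)
      ultimately have "pprt (b - a) = 0" by (simp add: inf_absorb2)
      then have "b \<le> a" by (simp add: pprt_eq_0_iff)
      then have "norm b \<le> norm a" using b0 by (rule norm_mono[rotated])
      then show False using nb na by simp
    qed
    ultimately have "inf b (pprt (a - b)) = 0"
      unfolding b_def p_def using c by (intro inf_scaleR_eq_0) (auto simp: inf_commute)
    then have "b = b - inf b (pprt (a - b))" by simp
    also have "\<dots> = pprt (b - pprt (a - b))"
      by (simp add: diff_inf_eq_sup add_sup_distrib_left pprt_def sup_commute)
    also have "\<dots> \<le> pprt ((2 * c) *\<^sub>R y - a)"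
    proof (rule pprt_mono)
      have "b - pprt (a - b) \<le> b - (a - b)" by (intro diff_left_mono le_pprt)
      also have "\<dots> = (2 * c) *\<^sub>R y - a" by (simp add: b_def algebra_simps flip: scaleR_2)
      finally show "b - pprt (a - b) \<le> (2 * c) *\<^sub>R y - a" .
    qed
    finally show ?thesis .
  qed
  then have "b \<le> 0" using van c unfolding vanishing_below_def by (metis mult_pos_pos zero_less_numeral)
  then have "b = 0" using b0 by (rule antisym)
  then show False using nb by simp
qed

text \<open>Splitting is iterated: of each disjoint pair \<open>(p, q)\<close>, the element
  \<open>q\<close> is set aside as a member of the sequence and \<open>p\<close> is split again.
  Later members lie below \<open>p\<close> and are thus disjoint from \<open>q\<close>.\<close>

lemma vanishing_below_disjoint_sequence:
  fixes x :: "'a::normed_lattice"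
  assumes A: "A \<subseteq> cball 0 1 \<inter> {0..}" and x: "0 < x" and van: "vanishing_below A x"
  shows "\<exists>s :: nat \<Rightarrow> 'a. (\<forall>n. 0 < s n \<and> s n \<le> x) \<and> (\<forall>m n. m \<noteq> n \<longrightarrow> inf (s m) (s n) = 0)"
proof -
  define P where "P = (\<lambda>(n::nat) (p, q). 0 < p \<and> 0 < q \<and> p \<le> x \<and> q \<le> x \<and> inf p q = 0)"
  define Q where "Q = (\<lambda>(n::nat) (p, q::'a) (p', q'). p' \<le> p \<and> q' \<le> (p::'a))"
  have "\<exists>f. \<forall>n. P n (f n) \<and> Q n (f n) (f (Suc n))"
  proof (rule dependent_nat_choice)
    show "\<exists>u. P 0 u"
      using vanishing_below_split[OF A x van] by (auto simp: P_def)
  next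
    fix u n assume "P n u"
    then obtain p q where u: "u = (p, q)" and p: "0 < p" "p \<le> x" by (auto simp: P_def)
    obtain p' q' where "0 < p'" "0 < q'" "p' \<le> p" "q' \<le> p" "inf p' q' = 0"
      using vanishing_below_split[OF A p(1) vanishing_below_mono[OF van p(2)]] by blast
    then have "P (Suc n) (p', q') \<and> Q n u (p', q')"
      using p u by (auto simp: P_def Q_def)
    then show "\<exists>v. P (Suc n) v \<and> Q n u v" ..
  qed
  then obtain f where f: "\<And>n. P n (f n)" "\<And>n. Q n (f n) (f (Suc n))" by blast
  define p where "p n = fst (f n)" for n
  define s where "s n = snd (f n)" for n
  have s: "0 < s n" "s n \<le> x" "inf (p n) (s n) = 0" for n
    using f(1)[of n] by (auto simp: P_def p_def s_def split: prod.splits)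
  have ps: "p (Suc n) \<le> p n" "s (Suc n) \<le> p n" for n
    using f(2)[of n] by (auto simp: Q_def p_def s_def split: prod.splits)
  have less: "inf (s m) (s n) = 0" if mn: "m < n" for m n
  proof -
    obtain k where n: "n = Suc k" "m \<le> k" using mn by (cases n) auto
    have "p k \<le> p m" using n(2) ps(1) by (rule lift_Suc_antimono_le[rotated])
    then have "s n \<le> p m" using ps(2)[of k] n(1) by simp
    then have "inf (s n) (s m) = 0"
      using s(1)[of m] s(1)[of n] by (intro inf_zero_mono[OF s(3)[of m]]) (auto intro: less_imp_le)
    then show ?thesis by (simp add: inf_commute)
  qed
  have "inf (s m) (s n) = 0" if "m \<noteq> n" for m n
    using less[of m n] less[of n m] that by (metis inf_commute nat_neq_iff)
  then show ?thesis using s by blast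
qed

lemma (in universal_completion_embedding) monotonically_completeI:
  assumes dom: "\<And>A. A \<subseteq> cball 0 1 \<inter> {0..} \<Longrightarrow> directed_by A (\<le>) \<Longrightarrow> bdd_above (j ` A) \<Longrightarrow>
    \<exists>s. isLub UNIV A s"
  shows "monotonically_complete TYPE('a)"
  unfolding monotonically_complete_def
proof (intro allI impI)
  fix A :: "'a set" assume A: "A \<subseteq> cball 0 1 \<inter> {0..}" and dir: "directed_by A (\<le>)"
  have A0: "A \<subseteq> {0..}" and Ane: "A \<noteq> {}" using A dir by (auto simp: directed_by_def)
  have "bdd_above (j ` A)"
  proof (rule ccontr)
    assume nb: "\<not> bdd_above (j ` A)"
    obtain x where x: "0 < x" and glb: "\<And>c. isGlb UNIV ((\<lambda>a. pprt (c *\<^sub>R x - a)) ` A) 0"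
      using bdd_above_or_unbounded_below[OF A0 Ane nb] by blast
    have van: "vanishing_below A x"
      using glb unfolding vanishing_below_def isGlb_UNIV_iff by simp
    obtain s :: "nat \<Rightarrow> 'a" where s: "\<And>n. 0 < s n" "\<And>n. s n \<le> x"
      and disj: "\<And>m n. m \<noteq> n \<Longrightarrow> inf (s m) (s n) = 0"
      using vanishing_below_disjoint_sequence[OF A x van] by blast
    \<comment> \<open>The norm of \<open>w n\<close> becomes \<open>(n + 1) 2 ^ Suc n\<close>, which
      stays unbounded after multiplication by the weight \<open>1 / 2 ^ Suc n\<close> in
      \<open>t\<close>.\<close>
    define c where "c n = (real n + 1) * 2 ^ Suc n / norm (s n)" for n
    have sn: "norm (s n) > 0" for n using s(1)[of n] by auto
    have c: "c n > 0" for n using sn by (simp add: c_def)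
    define w where "w n = c n *\<^sub>R s n" for n
    have nw: "norm (w n) = (real n + 1) * 2 ^ Suc n" for n
      using sn[of n] by (simp add: w_def c_def)
    have w0: "0 \<le> w n" for n
      using c[of n] s(1)[of n] by (simp add: w_def scaleR_nonneg_nonneg less_imp_le)
    have wdisj: "inf (w m) (w n) = 0" if "m \<noteq> n" for m n
    proof -
      have "inf (w m) (s n) = 0"
        unfolding w_def using disj[OF that] c[of m] by (intro inf_scaleR_eq_0) auto
      then have "inf (w n) (w m) = 0"
        unfolding w_def[of n] using c[of n] by (intro inf_scaleR_eq_0) (auto simp: inf_commute)
      then show ?thesis by (simp add: inf_commute)
    qed
    define t where "t a i = (1 / 2 ^ Suc i) *\<^sub>R inf a (w i)" for a i
    have t0: "0 \<le> t a i" if "a \<in> A" for a i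
      using that A0 w0 unfolding t_def by (intro scaleR_nonneg_nonneg) auto
    \<comment> \<open>Letting both the length \<open>k\<close> and the element \<open>a\<close> vary
      makes the set directed. The weights add up to less than 1, which keeps it in the unit
      ball.\<close>
    define S where "S = (\<lambda>(k::nat, a). \<Sum>i<k. t a i) ` (UNIV \<times> A)"
    have S_mono: "(\<Sum>i<k. t a i) \<le> (\<Sum>i<l. t b i)" if "k \<le> l" "a \<in> A" "b \<in> A" "a \<le> b" for k l a b
    proof -
      have "(\<Sum>i<k. t a i) \<le> (\<Sum>i<k. t b i)"
        unfolding t_def using that by (intro sum_mono scaleR_left_mono inf_mono) auto
      also have "\<dots> \<le> (\<Sum>i<l. t b i)"
        using that t0 by (intro sum_mono2) auto
      finally show ?thesis .
    qed
    have S1: "S \<subseteq> cball 0 1 \<inter> {0..}"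
    proof -
      have "norm (\<Sum>i<k. t a i) \<le> 1" if "a \<in> A" for k a
      proof -
        have "norm (t a i) \<le> 1 / 2 ^ Suc i" for i
        proof -
          have "norm (inf a (w i)) \<le> norm a" using that A0 w0 by (intro norm_mono) auto
          also have "\<dots> \<le> 1" using that A by auto
          finally show ?thesis by (simp add: t_def divide_simps)
        qed
        then have "norm (\<Sum>i<k. t a i) \<le> (\<Sum>i<k. 1 / 2 ^ Suc i)"
          by (intro sum_norm_le) auto
        also have "(\<Sum>i<k. 1 / 2 ^ Suc i) = 1 - 1 / (2::real) ^ k"
          by (induction k) (auto simp: field_simps)
        also have "\<dots> \<le> 1" by simp
        finally show ?thesis .
      qed
      then show ?thesis using t0 by (auto simp: S_def intro!: sum_nonneg)
    qed
    have Sdir: "directed_by S (\<le>)"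
    proof -
      have "\<exists>r\<in>S. (\<Sum>i<k. t a i) \<le> r \<and> (\<Sum>i<l. t b i) \<le> r" if ab: "a \<in> A" "b \<in> A" for k l a b
      proof -
        obtain e where "e \<in> A" "a \<le> e" "b \<le> e" using dir ab by (auto simp: directed_by_def)
        then show ?thesis
          using S_mono[of k "max k l" a e] S_mono[of l "max k l" b e] ab
          by (intro bexI[of _ "\<Sum>i<max k l. t e i"]) (auto simp: S_def)
      qed
      then show ?thesis
        using Ane by (auto simp: directed_by_def S_def intro!: reflp_onI transp_onI)
    qed
    \<comment> \<open>The disjoint elements \<open>j (w n)\<close> have a common bound
      \<open>M\<close> in the universal completion. The terms \<open>t a i\<close> lie below
      \<open>w i\<close> and are disjoint, so their sums stay below \<open>M\<close> as
      well.\<close>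
    have "bdd_above (j ` S)"
    proof -
      have "disjoint_set (range (\<lambda>n. j (w n)))"
        unfolding disjoint_set_def
      proof (rule pairwise_imageI)
        fix m n :: nat assume "m \<noteq> n"
        then show "inf \<bar>j (w m)\<bar> \<bar>j (w n)\<bar> = 0"
          using wdisj[of m n] w0[of m] w0[of n] j_inf[of "w m" "w n"] by simp
      qed
      moreover have "range (\<lambda>n. j (w n)) \<subseteq> {0..}" using w0 by auto
      ultimately have "bdd_above (range (\<lambda>n. j (w n)))"
        using universally_complete unfolding universally_complete_def by simp
      then obtain M where M: "\<And>n. j (w n) \<le> M" by (auto simp: bdd_above_def)
      have M0: "0 \<le> M" using M[of 0] w0[of 0] j_nonneg_iff order_trans by blast
      have "j (\<Sum>i<k. t a i) \<le> M" if "a \<in> A" for k a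
      proof -
        have tw: "t a i \<le> w i" for i
        proof -
          have "t a i \<le> inf a (w i)"
            unfolding t_def using that A0 w0 by (intro scaleR_left_le_one_le) (auto simp del: power_Suc)
          then show ?thesis by simp
        qed
        have "(\<Sum>i<k. j (t a i)) \<le> M"
        proof (rule sum_disjoint_le)
          fix i show "0 \<le> j (t a i) \<and> j (t a i) \<le> M"
            using t0[OF that] tw[of i] M[of i] j_le_iff order_trans by (metis j_nonneg_iff)
        next
          fix i l :: nat assume "i \<noteq> l"
          then have "inf (t a i) (t a l) = 0"
            using tw t0[OF that] by (intro inf_zero_mono[OF wdisj])
          then show "inf (j (t a i)) (j (t a l)) = 0" by (simp flip: j_inf)
        qed (use M0 in auto)
        then show ?thesis using linear by (simp add: linear_sum)
      qed
      then show ?thesis by (intro bdd_aboveI[of _ M]) (auto simp: S_def)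
    qed
    then obtain \<sigma> where \<sigma>: "isLub UNIV S \<sigma>" using dom[OF S1 Sdir] by blast
    have \<sigma>_norm: "real n + 1 \<le> norm \<sigma>" for n
    proof -
      \<comment> \<open>A supremum \<open>\<sigma>\<close> would dominate each single term, so
        \<open>inf a (w n)\<close> lies below \<open>2 ^ Suc n\<close> times \<open>\<sigma>\<close>
        for all \<open>a\<close>. As \<open>A\<close> vanishes below \<open>s n\<close>, even
        \<open>w n\<close> lies below that multiple, which makes the norm of \<open>\<sigma>\<close>
        infinite.\<close>
      have "w n - (2 ^ Suc n) *\<^sub>R \<sigma> \<le> pprt (c n *\<^sub>R s n - a)" if a: "a \<in> A" for a
      proof -
        have "t a n \<le> (\<Sum>i<Suc n. t a i)"
          using t0[OF a] sum_nonneg[of "{..<n}" "t a"] by (simp add: add_increasing)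
        also have "\<dots> \<le> \<sigma>" using \<sigma> a by (auto simp: isLub_UNIV_iff S_def simp del: sum.lessThan_Suc)
        finally have "(2 ^ Suc n) *\<^sub>R t a n \<le> (2 ^ Suc n) *\<^sub>R \<sigma>" by (intro scaleR_left_mono) auto
        then have "inf a (w n) \<le> (2 ^ Suc n) *\<^sub>R \<sigma>" by (simp add: t_def)
        then have "w n - (2 ^ Suc n) *\<^sub>R \<sigma> \<le> w n - inf a (w n)" by (rule diff_left_mono)
        also have "\<dots> = pprt (c n *\<^sub>R s n - a)"
          by (simp add: diff_inf_eq_sup add_sup_distrib_left pprt_def w_def)
        finally show ?thesis .
      qed
      then have "w n - (2 ^ Suc n) *\<^sub>R \<sigma> \<le> 0"
        using vanishing_below_mono[OF van s(2)[of n]] c[of n] unfolding vanishing_below_def by blast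
      then have "norm (w n) \<le> norm ((2 ^ Suc n) *\<^sub>R \<sigma>)"
        using w0 by (intro norm_mono) auto
      then have "(real n + 1) * 2 ^ Suc n \<le> norm \<sigma> * 2 ^ Suc n" by (simp add: nw mult.commute)
      then show ?thesis by (rule mult_right_le_imp_le) simp
    qed
    obtain n :: nat where "norm \<sigma> < real n" using reals_Archimedean2 by blast
    then show False using \<sigma>_norm[of n] by simp
  qed
  then show "\<exists>s. isLub UNIV A s" using dom A dir by blast
qed

section \<open>Disjoint completeness\<close>

text \<open>The second half of condition (iii). The empty set is excluded because a supremum of it
  in \<open>UNIV\<close> would be a least element, which a nonzero vector lattice does not
  have.\<close>

definition disjointly_complete :: "'a::normed_lattice itself \<Rightarrow> bool" where
  "disjointly_complete _ \<longleftrightarrow>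
     (\<forall>D::'a set. D \<noteq> {} \<longrightarrow> D \<subseteq> {0..} \<longrightarrow> disjoint_set D \<longrightarrow> finite_sups D \<subseteq> cball 0 1 \<longrightarrow>
        (\<exists>s. isLub UNIV D s))"

text \<open>Finite joins are controlled through majorants: after scaling by \<open>c\<close>, every
  finite join lies between 0 and a scaled majorant, so solidity of the norm places it in the unit
  ball.\<close>

lemma isLub_of_bounded_disjoint:
  fixes D :: "'a::normed_lattice set"
  assumes dc: "disjointly_complete TYPE('a)"
    and D: "D \<noteq> {}" "D \<subseteq> {0..}" "pairwise (\<lambda>x y. inf x y = 0) D"
    and bound: "\<And>S. finite S \<Longrightarrow> S \<subseteq> D \<Longrightarrow> \<exists>b. norm b \<le> C \<and> (\<forall>d\<in>S. d \<le> b)"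
  shows "\<exists>s. isLub UNIV D s"
proof -
  define c where "c = 1 / (\<bar>C\<bar> + 1)"
  have c: "c > 0" by (simp add: c_def)
  have "finite_sups ((*\<^sub>R) c ` D) \<subseteq> cball 0 1"
  proof
    fix y assume "y \<in> finite_sups ((*\<^sub>R) c ` D)"
    then obtain T where T: "y = Sup_fin T" "finite T" "T \<noteq> {}" "T \<subseteq> (*\<^sub>R) c ` D"
      unfolding finite_sups_def by blast
    obtain S where S: "S \<subseteq> D" "finite S" "T = (*\<^sub>R) c ` S"
      using finite_subset_image[OF T(2,4)] by blast
    obtain b where b: "norm b \<le> C" "\<forall>d\<in>S. d \<le> b" using bound[OF S(2,1)] by blast
    have "y \<le> c *\<^sub>R b"
      unfolding T(1) using T(2,3) S(3) b(2) c by (intro Sup_fin.boundedI) (auto intro: scaleR_left_mono)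
    moreover have "0 \<le> y"
    proof -
      obtain t where t: "t \<in> T" using T(3) by blast
      then have "0 \<le> t" using S D(2) c by (auto intro!: scaleR_nonneg_nonneg)
      also have "t \<le> y" unfolding T(1) using T(2) t by (rule Sup_fin.coboundedI)
      finally show ?thesis .
    qed
    ultimately have "norm y \<le> norm (c *\<^sub>R b)" by (intro norm_mono)
    also have "\<dots> = norm b / (\<bar>C\<bar> + 1)" by (simp add: c_def)
    also have "\<dots> \<le> 1" using b(1) by (subst divide_le_eq) auto
    finally show "y \<in> cball 0 1" by simp
  qed
  moreover have "(*\<^sub>R) c ` D \<subseteq> {0..}" using D(2) c by (auto intro!: scaleR_nonneg_nonneg)
  moreover have "disjoint_set ((*\<^sub>R) c ` D)"
    unfolding disjoint_set_def
  proof (rule pairwise_imageI)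
    fix x y assume xy: "x \<in> D" "y \<in> D" "x \<noteq> y"
    then have "inf x y = 0" using D(3) by (auto simp: pairwise_def)
    then have "inf (c *\<^sub>R x) y = 0" using c by (intro inf_scaleR_eq_0) auto
    then have "inf (c *\<^sub>R y) (c *\<^sub>R x) = 0"
      using c by (intro inf_scaleR_eq_0) (auto simp: inf_commute)
    moreover have "0 \<le> c *\<^sub>R x" "0 \<le> c *\<^sub>R y"
      using xy D(2) c by (auto intro!: scaleR_nonneg_nonneg)
    ultimately show "inf \<bar>c *\<^sub>R x\<bar> \<bar>c *\<^sub>R y\<bar> = 0" by (simp add: inf_commute)
  qed
  moreover have "(*\<^sub>R) c ` D \<noteq> {}" using D(1) by simp
  ultimately obtain s where "isLub UNIV ((*\<^sub>R) c ` D) s"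
    using dc unfolding disjointly_complete_def by meson
  then show ?thesis using isLub_scaleR[OF c] by blast
qed

section \<open>Principal band projections from disjoint completeness\<close>

lemma pprt_scaleR:
  fixes x :: "'a::vector_lattice"
  shows "0 \<le> c \<Longrightarrow> pprt (c *\<^sub>R x) = c *\<^sub>R pprt x"
  by (simp add: pprt_def scaleR_sup)

text \<open>With \<open>v\<close> standing for \<open>z / x\<close>, the element \<open>t n\<close> below with \<open>n \<ge> 1\<close> is a hat function of \<open>v\<close>
  supported where \<open>2^(- n) \<le> v \<le> 2^(2 - n)\<close>, and all of them sum to the projection of \<open>x\<close>. Those with
  even index are mutually disjoint, and so are those with odd index, so that disjoint completeness
  provides the sums of these two families.\<close>

lemma ex_band_projection_disjointly_complete:
  fixes z :: "'a::normed_lattice"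
  assumes dc: "disjointly_complete TYPE('a)" and z: "0 \<le> z" and x: "0 \<le> x"
  shows "\<exists>d. is_band_projection z x d"
proof -
  \<comment> \<open>\<open>L m\<close> vanishes where \<open>2 ^ m *\<^sub>R z \<le> x\<close> and
    equals \<open>x\<close> where \<open>2 ^ m *\<^sub>R z \<ge> 2 *\<^sub>R x\<close>. Prepending
    \<open>K 0 = 0\<close> makes the differences \<open>t\<close> telescope to
    \<open>K\<close>.\<close>
  define L where "L m = inf (pprt (2 ^ m *\<^sub>R z - x)) x" for m :: nat
  define K where "K n = (case n of 0 \<Rightarrow> 0 | Suc m \<Rightarrow> L m)" for n
  define t where "t n = K (Suc n) - K n" for n
  have L0: "0 \<le> L m" and Lx: "L m \<le> x" for m using x by (auto simp: L_def)
  have L_mono: "L m \<le> L (Suc m)" for m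
    unfolding L_def using z
    by (intro inf_mono pprt_mono diff_right_mono scaleR_right_mono power_increasing) auto
  have K0: "0 \<le> K n" and Kx: "K n \<le> x" and K_mono: "K n \<le> K (Suc n)" for n
    using L0 Lx L_mono x by (auto simp: K_def split: nat.splits)
  have t0: "0 \<le> t n" and tx: "t n \<le> x" for n
    using K_mono[of n] K0[of n] Kx[of "Suc n"] by (auto simp: t_def intro: diff_le_eq[THEN iffD2] add_increasing2)
  have x_minus_L: "x - L m \<le> pprt (2 *\<^sub>R x - 2 ^ m *\<^sub>R z)" for m
  proof -
    have "x - L m = pprt (x - pprt (2 ^ m *\<^sub>R z - x))"
      by (simp add: L_def diff_inf_eq_sup add_sup_distrib_left pprt_def)
    also have "\<dots> \<le> pprt (x - (2 ^ m *\<^sub>R z - x))"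
      by (intro pprt_mono diff_left_mono le_pprt)
    also have "x - (2 ^ m *\<^sub>R z - x) = 2 *\<^sub>R x - 2 ^ m *\<^sub>R z" by (simp add: scaleR_2)
    finally show ?thesis .
  qed
  \<comment> \<open>\<open>t n\<close> lies below \<open>pprt (2 ^ n *\<^sub>R z - x)\<close>, while
    \<open>t m\<close> lies below twice \<open>pprt (x - 2 ^ n *\<^sub>R z)\<close>.\<close>
  have t_disj: "inf (t n) (t m) = 0" if nm: "n + 2 \<le> m" for n m
  proof -
    obtain k where k: "m = Suc k" "n + 1 \<le> k" using nm by (cases m) auto
    have "t m \<le> x - L k"
      using Kx[of "Suc m"] by (simp add: t_def k(1) K_def)
    also have "\<dots> \<le> pprt (2 *\<^sub>R x - 2 ^ k *\<^sub>R z)" by (rule x_minus_L)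
    also have "\<dots> \<le> pprt (2 *\<^sub>R x - 2 ^ (n + 1) *\<^sub>R z)"
      using z k(2) by (intro pprt_mono diff_left_mono scaleR_right_mono power_increasing) auto
    also have "2 *\<^sub>R x - 2 ^ (n + 1) *\<^sub>R z = 2 *\<^sub>R (x - 2 ^ n *\<^sub>R z)" by (simp add: scaleR_diff_right)
    also have "pprt (2 *\<^sub>R (x - 2 ^ n *\<^sub>R z)) = 2 *\<^sub>R pprt (x - 2 ^ n *\<^sub>R z)"
      by (simp add: pprt_scaleR)
    finally have tm: "t m \<le> 2 *\<^sub>R pprt (x - 2 ^ n *\<^sub>R z)" .
    have "t n \<le> L n" using K0[of n] by (simp add: t_def K_def[of "Suc n"])
    also have "\<dots> \<le> pprt (2 ^ n *\<^sub>R z - x)" by (simp add: L_def)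
    finally have tn: "t n \<le> pprt (2 ^ n *\<^sub>R z - x)" .
    have "inf (2 *\<^sub>R pprt (x - 2 ^ n *\<^sub>R z)) (pprt (2 ^ n *\<^sub>R z - x)) = 0"
      by (intro inf_scaleR_eq_0 inf_pprt_diff) simp
    then have "inf (t m) (t n) = 0" by (rule inf_zero_mono[OF _ t0 tm t0 tn])
    then show ?thesis by (simp add: inf_commute)
  qed
  have lub_family: "\<exists>s. isLub UNIV (range (\<lambda>i. t (2 * i + r))) s" for r
  proof (rule isLub_of_bounded_disjoint[OF dc])
    show "range (\<lambda>i. t (2 * i + r)) \<subseteq> {0..}" using t0 by auto
    show "pairwise (\<lambda>x y. inf x y = 0) (range (\<lambda>i. t (2 * i + r)))"
    proof (rule pairwise_imageI)
      fix i l :: nat assume "i \<noteq> l"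
      then consider "i < l" | "l < i" by linarith
      then show "inf (t (2 * i + r)) (t (2 * l + r)) = 0"
      proof cases
        case 2
        then show ?thesis using t_disj[of "2 * l + r" "2 * i + r"] by (simp add: inf_commute)
      qed (simp add: t_disj)
    qed
    show "\<exists>b. norm b \<le> norm x \<and> (\<forall>d\<in>S. d \<le> b)" if "S \<subseteq> range (\<lambda>i. t (2 * i + r))" for S
      using that tx by (intro exI[of _ x]) auto
  qed simp
  obtain e where e: "isLub UNIV (range (\<lambda>i. t (2 * i))) e" using lub_family[of 0] by auto
  obtain o' where o': "isLub UNIV (range (\<lambda>i. t (2 * i + 1))) o'" using lub_family[of 1] by blast
  have te: "t (2 * i) \<le> e" and to: "t (2 * i + 1) \<le> o'" for i
    using e o' by (auto simp: isLub_UNIV_iff)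
  have e0: "0 \<le> e" "0 \<le> o'"
    using te[of 0] to[of 0] t0[of 0] t0[of 1] by auto
  have sum_t: "(\<Sum>i<n. t i) = K n" for n
    by (induction n) (auto simp: t_def K_def[of 0])
  define d where "d = e + o'"
  have Kd: "K n \<le> d" for n
  proof -
    have "K n = (\<Sum>i<n. t i)" by (simp add: sum_t)
    \<comment> \<open>Doubling the length gives equally many even and odd indices. Within each
      parity the terms are disjoint, so their sums are bounded by \<open>e\<close> and
      \<open>o'\<close>.\<close>
    also have "\<dots> \<le> (\<Sum>i<2 * n. t i)" using t0 by (intro sum_mono2) auto
    also have "\<dots> = (\<Sum>i<n. t (2 * i)) + (\<Sum>i<n. t (2 * i + 1))"
      by (induction n) (auto simp: algebra_simps)
    also have "\<dots> \<le> e + o'"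
    proof (intro add_mono sum_disjoint_le)
      fix i l :: nat assume "i \<noteq> l"
      then consider "i < l" | "l < i" by linarith
      then have "inf (t (2 * i)) (t (2 * l)) = 0 \<and> inf (t (2 * i + 1)) (t (2 * l + 1)) = 0"
      proof cases
        case 2
        then show ?thesis
          using t_disj[of "2 * l" "2 * i"] t_disj[of "2 * l + 1" "2 * i + 1"] by (simp add: inf_commute)
      qed (simp add: t_disj)
      then show "inf (t (2 * i)) (t (2 * l)) = 0" "inf (t (2 * i + 1)) (t (2 * l + 1)) = 0"
        by blast+
    qed (use e0 t0 te to in auto)
    finally show ?thesis by (simp add: d_def)
  qed
  have d_least: "d \<le> b" if b: "\<And>n. K n \<le> b" for b
  proof -
    \<comment> \<open>An even and an odd index never coincide, so both terms occur in one partial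
      sum, which is a value of \<open>K\<close>. Suprema are then taken over \<open>i\<close> and
      afterwards over \<open>l\<close>.\<close>
    have "t (2 * i) \<le> b - t (2 * l + 1)" for i l
    proof -
      have "2 * i \<noteq> 2 * l + 1" by presburger
      then have "t (2 * i) + t (2 * l + 1) = (\<Sum>n\<in>{2 * i, 2 * l + 1}. t n)" by simp
      also have "\<dots> \<le> (\<Sum>n<2 * i + 2 * l + 2. t n)" using t0 by (intro sum_mono2) auto
      also have "\<dots> \<le> b" unfolding sum_t by (rule b)
      finally show ?thesis by (simp add: algebra_simps)
    qed
    then have "e \<le> b - t (2 * l + 1)" for l using e by (auto simp: isLub_UNIV_iff)
    then have "t (2 * l + 1) \<le> b - e" for l by (simp add: algebra_simps)
    then have "o' \<le> b - e" using o' by (auto simp: isLub_UNIV_iff)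
    then show ?thesis by (simp add: d_def algebra_simps)
  qed
  have d_lub: "isLub UNIV (range K) d"
    using Kd d_least by (auto simp: isLub_UNIV_iff)
  have d0: "0 \<le> d" using Kd[of 0] by (simp add: K_def)
  have dx: "d \<le> x" using Kx by (rule d_least)
  define y where "y = inf (x - d) z"
  have y0: "0 \<le> y" using dx z by (simp add: y_def)
  \<comment> \<open>As \<open>y\<close> lies below \<open>pprt (2 *\<^sub>R x - c)\<close>, its
    multiples are disjoint from \<open>pprt (c - 2 *\<^sub>R x)\<close>. The excess of
    \<open>2 ^ m *\<^sub>R y\<close> over \<open>2 *\<^sub>R x\<close> lies below both a multiple of
    \<open>y\<close> and that element, so it is 0.\<close>
  have y_le: "2 ^ m *\<^sub>R y \<le> 2 *\<^sub>R x" for m :: nat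
  proof -
    define c where "c = 2 ^ m *\<^sub>R z"
    have "y \<le> x - d" by (simp add: y_def)
    also have "\<dots> \<le> x - L m" using Kd[of "Suc m"] by (simp add: K_def diff_left_mono)
    also have "\<dots> \<le> pprt (2 *\<^sub>R x - c)" unfolding c_def by (rule x_minus_L)
    finally have y1: "y \<le> pprt (2 *\<^sub>R x - c)" .
    have "inf y (pprt (c - 2 *\<^sub>R x)) = 0"
      by (rule inf_zero_mono[OF inf_pprt_diff[of "2 *\<^sub>R x" c] y0 y1]) auto
    then have *: "inf (2 ^ m *\<^sub>R y) (pprt (c - 2 *\<^sub>R x)) = 0" by (intro inf_scaleR_eq_0) auto
    have "2 ^ m *\<^sub>R y \<le> c" unfolding c_def y_def by (intro scaleR_left_mono) auto
    then have 1: "pprt (2 ^ m *\<^sub>R y - 2 *\<^sub>R x) \<le> pprt (c - 2 *\<^sub>R x)"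
      by (intro pprt_mono diff_right_mono)
    have "2 ^ m *\<^sub>R y - 2 *\<^sub>R x \<le> 2 ^ m *\<^sub>R y" using x by (simp add: scaleR_nonneg_nonneg)
    then have 2: "pprt (2 ^ m *\<^sub>R y - 2 *\<^sub>R x) \<le> 2 ^ m *\<^sub>R y"
      using y0 by (simp add: pprt_le_iff scaleR_nonneg_nonneg)
    have "pprt (2 ^ m *\<^sub>R y - 2 *\<^sub>R x) \<le> 0" using inf_greatest[OF 2 1] * by simp
    then show ?thesis by (simp add: pprt_le_iff)
  qed
  have "y = 0"
  proof (rule archimedean_normed_lattice[OF y0])
    fix n :: nat
    have "real n \<le> 2 ^ n" by (simp add: less_imp_le)
    then have "real n *\<^sub>R y \<le> 2 ^ n *\<^sub>R y" using y0 by (rule scaleR_right_mono)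
    also have "\<dots> \<le> 2 *\<^sub>R x" by (rule y_le)
    finally show "real n *\<^sub>R y \<le> 2 *\<^sub>R x" .
  qed
  moreover have "inf d w = 0" if w: "0 \<le> w" "inf z w = 0" for w
  proof (rule isLub_inf_eq_0[OF d_lub])
    fix k assume "k \<in> range K"
    then obtain n where k: "k = K n" by blast
    have "K n \<le> 2 ^ n *\<^sub>R z"
    proof (cases n)
      case 0
      then show ?thesis using z by (simp add: K_def)
    next
      case (Suc m)
      have "L m \<le> pprt (2 ^ m *\<^sub>R z - x)" by (simp add: L_def)
      also have "\<dots> \<le> 2 ^ m *\<^sub>R z" using x z by (simp add: pprt_le_iff scaleR_nonneg_nonneg)
      also have "\<dots> \<le> 2 ^ n *\<^sub>R z"
        using z Suc by (intro scaleR_right_mono power_increasing) auto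
      finally show ?thesis using Suc by (simp add: K_def)
    qed
    moreover have "inf (2 ^ n *\<^sub>R z) w = 0" using w(2) by (rule inf_scaleR_eq_0) simp
    ultimately show "0 \<le> k \<and> inf k w = 0"
      using K0 w(1) inf_zero_mono[of "2 ^ n *\<^sub>R z" w k w] by (simp add: k)
  qed (use w in auto)
  ultimately show ?thesis
    using d0 dx unfolding is_band_projection_def y_def by blast
qed

section \<open>Suprema of dominable directed sets from disjoint completeness\<close>

lemma directed_finite_bound:
  assumes "directed_by A (\<le>)" "finite S" "\<And>s. s \<in> S \<Longrightarrow> \<exists>a\<in>A. s \<le> a"
  shows "\<exists>e\<in>A. \<forall>s\<in>S. s \<le> (e::'a::order)"
  using assms(2,3)
proof (induction S)
  case empty
  then show ?case using assms(1) by (auto simp: directed_by_def)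
next
  case (insert s S)
  then obtain e a where e: "e \<in> A" "\<forall>s\<in>S. s \<le> e" "a \<in> A" "s \<le> a" by blast
  then obtain r where "r \<in> A" "e \<le> r" "a \<le> r" using assms(1) unfolding directed_by_def by metis
  then show ?case using e by (auto intro!: bexI[of _ r] intro: order_trans)
qed

text \<open>The positive cone is closed: because \<open>f n - g n \<le> 0\<close>, the element
  \<open>pprt (a - b)\<close> is dominated by the absolute value of
  \<open>(f n - g n) - (a - b)\<close>, whose norm tends to 0.\<close>

lemma LIMSEQ_le_normed_lattice:
  fixes f g :: "nat \<Rightarrow> 'a::normed_lattice"
  assumes "f \<longlonglongrightarrow> a" "g \<longlonglongrightarrow> b" "\<And>n. f n \<le> g n"
  shows "a \<le> b"
proof -
  have lim: "(\<lambda>n. norm ((f n - g n) - (a - b))) \<longlonglongrightarrow> 0"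
    using tendsto_diff[OF assms(1,2)] by (simp add: LIM_zero_iff tendsto_norm_zero_iff)
  have "norm (pprt (a - b)) \<le> norm ((f n - g n) - (a - b))" for n
  proof (rule norm_solid)
    have "a - b \<le> - ((f n - g n) - (a - b))" using assms(3)[of n] by simp
    also have "\<dots> \<le> \<bar>(f n - g n) - (a - b)\<bar>" by (rule abs_ge_minus_self)
    finally show "\<bar>pprt (a - b)\<bar> \<le> \<bar>(f n - g n) - (a - b)\<bar>" by (simp add: pprt_le_iff)
  qed
  then have "norm (pprt (a - b)) \<le> 0"
    by (intro LIMSEQ_le_const[OF lim]) auto
  then show ?thesis by (simp add: pprt_eq_0_iff)
qed

lemma (in universal_completion_embedding) ex_approximate_supremum:
  assumes dc: "disjointly_complete TYPE('a)"
    and A: "A \<subseteq> cball 0 1 \<inter> {0..}" "directed_by A (\<le>)" "bdd_above (j ` A)"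
    and \<epsilon>: "0 < \<epsilon>"
  shows "\<exists>v. (\<forall>b. (\<forall>a\<in>A. a \<le> b) \<longrightarrow> v \<le> b) \<and> (\<forall>a\<in>A. a \<le> (1 + \<epsilon>) *\<^sub>R v)"
proof -
  have Ane: "A \<noteq> {}" using A(2) by (auto simp: directed_by_def)
  obtain u where u: "isLub UNIV (j ` A) u"
    using universally_complete A(3) Ane unfolding universally_complete_def by (metis image_is_empty)
  have au: "j a \<le> u" if "a \<in> A" for a using u that by (auto simp: isLub_UNIV_iff)
  have a0: "0 \<le> a" if "a \<in> A" for a using A(1) that by auto
  obtain a1 where a1: "a1 \<in> A" using Ane by blast
  have "0 \<le> j a1" using a0[OF a1] by simp
  then have u0: "0 \<le> u" using au[OF a1] by (rule order_trans)
  \<comment> \<open>\<open>R z\<close> says that a single \<open>a\<close> in \<open>A\<close>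
    satisfies \<open>u \<le> (1 + \<epsilon>) a\<close> on the band of \<open>z\<close>.\<close>
  define R where "R z = (\<exists>a\<in>A. inf (pprt (u - (1 + \<epsilon>) *\<^sub>R j a)) (j z) = 0)" for z
  have dense: "\<exists>y>0. R y \<and> j y \<le> g" if g: "0 < g" "g \<le> u" for g
  proof -
    \<comment> \<open>Otherwise \<open>g\<close> is disjoint from the positive part \<open>p\<close>
      of each \<open>(1 + \<epsilon>) a - u\<close>. Then \<open>\<epsilon> g + p\<close> is a join
      of two elements below \<open>\<epsilon> u\<close>, and rearranging shows that \<open>u\<close>
      minus a positive multiple of \<open>g\<close> is still an upper bound.\<close>
    have "\<exists>a\<in>A. inf g (pprt ((1 + \<epsilon>) *\<^sub>R j a - u)) \<noteq> 0"
    proof (rule ccontr)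
      assume "\<not> ?thesis"
      then have *: "inf g (pprt ((1 + \<epsilon>) *\<^sub>R j a - u)) = 0" if "a \<in> A" for a using that by blast
      have "j a \<le> u - (\<epsilon> *\<^sub>R g) /\<^sub>R (1 + \<epsilon>)" if a: "a \<in> A" for a
      proof -
        define p where "p = pprt ((1 + \<epsilon>) *\<^sub>R j a - u)"
        have "(1 + \<epsilon>) *\<^sub>R j a \<le> (1 + \<epsilon>) *\<^sub>R u" using au[OF a] \<epsilon> by (intro scaleR_left_mono) auto
        then have "p \<le> \<epsilon> *\<^sub>R u"
          using u0 \<epsilon> by (simp add: p_def pprt_le_iff scaleR_nonneg_nonneg scaleR_add_left algebra_simps)
        moreover have "\<epsilon> *\<^sub>R g \<le> \<epsilon> *\<^sub>R u" using g \<epsilon> by (intro scaleR_left_mono) auto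
        moreover have "\<epsilon> *\<^sub>R g + p = sup (\<epsilon> *\<^sub>R g) p"
          using *[OF a] \<epsilon> unfolding p_def by (intro add_eq_sup inf_scaleR_eq_0) auto
        ultimately have "\<epsilon> *\<^sub>R g + p \<le> \<epsilon> *\<^sub>R u" by simp
        moreover have "(1 + \<epsilon>) *\<^sub>R j a - u \<le> p" unfolding p_def by (rule le_pprt)
        ultimately have "\<epsilon> *\<^sub>R g + ((1 + \<epsilon>) *\<^sub>R j a - u) \<le> \<epsilon> *\<^sub>R u"
          by (meson add_left_mono order_trans)
        then have "(1 + \<epsilon>) *\<^sub>R j a \<le> (1 + \<epsilon>) *\<^sub>R u - \<epsilon> *\<^sub>R g"
          by (simp add: scaleR_add_left algebra_simps)
        also have "\<dots> = (1 + \<epsilon>) *\<^sub>R (u - (\<epsilon> *\<^sub>R g) /\<^sub>R (1 + \<epsilon>))"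
          using \<epsilon> by (simp add: scaleR_diff_right)
        finally show ?thesis using \<epsilon> by (simp add: scaleR_le_cancel_left_pos)
      qed
      then have "u \<le> u - (\<epsilon> *\<^sub>R g) /\<^sub>R (1 + \<epsilon>)" using u by (auto simp: isLub_UNIV_iff)
      then have "(\<epsilon> / (1 + \<epsilon>)) *\<^sub>R g \<le> 0" using \<epsilon> by (simp add: divide_inverse mult.commute)
      then have "g \<le> 0" using \<epsilon> by (simp add: scaleR_le_0_iff divide_less_0_iff)
      then show False using g by (simp add: less_le_not_le)
    qed
    then obtain a where a: "a \<in> A" "inf g (pprt ((1 + \<epsilon>) *\<^sub>R j a - u)) \<noteq> 0" by blast
    have "0 < inf g (pprt ((1 + \<epsilon>) *\<^sub>R j a - u))"
      using a(2) g(1) by (simp add: less_le)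
    then obtain y where y: "0 < y" "j y \<le> inf g (pprt ((1 + \<epsilon>) *\<^sub>R j a - u))"
      by (rule order_dense_range)
    have "inf (pprt (u - (1 + \<epsilon>) *\<^sub>R j a)) (j y) = 0"
      using y less_imp_le[OF y(1)] by (intro inf_zero_mono[OF inf_pprt_diff[of u "(1 + \<epsilon>) *\<^sub>R j a"]]) auto
    then have "R y" using a(1) unfolding R_def by blast
    then show ?thesis using y by auto
  qed
  obtain Z where Z: "\<forall>z\<in>Z. 0 < z \<and> R z" "pairwise (\<lambda>x y. inf x y = 0) Z"
    "\<forall>w\<ge>0. w \<le> u \<longrightarrow> (\<forall>z\<in>Z. inf w (j z) = 0) \<longrightarrow> w = 0"
    using ex_exhausting_disjoint[of "\<lambda>w. w \<le> u" R, OF dense] by blast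
  have "\<forall>z\<in>Z. \<exists>a\<in>A. inf (pprt (u - (1 + \<epsilon>) *\<^sub>R j a)) (j z) = 0" using Z(1) unfolding R_def by blast
  then obtain f where f: "\<And>z. z \<in> Z \<Longrightarrow> f z \<in> A"
    "\<And>z. z \<in> Z \<Longrightarrow> inf (pprt (u - (1 + \<epsilon>) *\<^sub>R j (f z))) (j z) = 0"
    by metis
  have "\<exists>d. is_band_projection z (f z) d" if "z \<in> Z" for z
    using bspec[OF Z(1) that] a0[OF f(1)[OF that]]
    by (intro ex_band_projection_disjointly_complete dc) auto
  then obtain d where d: "\<And>z. z \<in> Z \<Longrightarrow> is_band_projection z (f z) (d z)" by metis
  have d0: "0 \<le> d z" and df: "d z \<le> f z" if "z \<in> Z" for z
    using d[OF that] by (auto simp: is_band_projection_def)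
  \<comment> \<open>Inserting 0 keeps the set nonempty when \<open>Z\<close> is empty and makes
    \<open>v\<close> positive.\<close>
  have "\<exists>s. isLub UNIV (insert 0 (d ` Z)) s"
  proof (rule isLub_of_bounded_disjoint[OF dc])
    show "insert 0 (d ` Z) \<subseteq> {0..}" using d0 by auto
    have "inf (d z) (d z') = 0" if "z \<in> Z" "z' \<in> Z" "d z \<noteq> d z'" for z z'
      using is_band_projection_disjoint[OF d[of z] d[of z']] pairwiseD[OF Z(2), of z z'] that by blast
    then show "pairwise (\<lambda>x y. inf x y = 0) (insert 0 (d ` Z))"
      using d0 by (auto simp: pairwise_def inf_absorb1 inf_absorb2)
    fix S assume S: "finite S" "S \<subseteq> insert 0 (d ` Z)"
    \<comment> \<open>Each projection lies below the element of \<open>A\<close> that it comes from,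
      so directedness bounds finitely many of them by one element of the unit ball.\<close>
    have "\<exists>a\<in>A. s \<le> a" if "s \<in> S" for s
      using that S(2) a1 a0[OF a1] df f(1) by blast
    then obtain e where "e \<in> A" "\<forall>s\<in>S. s \<le> e" using directed_finite_bound[OF A(2) S(1)] by blast
    then show "\<exists>b. norm b \<le> 1 \<and> (\<forall>s\<in>S. s \<le> b)"
      using A(1) by (intro exI[of _ e]) auto
  qed simp
  then obtain v where v: "isLub UNIV (insert 0 (d ` Z)) v" ..
  have v0: "0 \<le> v" and dv: "\<And>z. z \<in> Z \<Longrightarrow> d z \<le> v" using v by (auto simp: isLub_UNIV_iff)
  have "v \<le> b" if b: "\<forall>a\<in>A. a \<le> b" for b
  proof -
    have "0 \<le> b" using a0[OF a1] bspec[OF b a1] by (rule order_trans)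
    moreover have "d z \<le> b" if "z \<in> Z" for z
      using df[OF that] bspec[OF b f(1)[OF that]] by (rule order_trans)
    ultimately show ?thesis using v by (auto simp: isLub_UNIV_iff)
  qed
  moreover have "a \<le> (1 + \<epsilon>) *\<^sub>R v" if a: "a \<in> A" for a
  proof -
    \<comment> \<open>On the band of each \<open>z\<close>, \<open>u \<le> (1 + \<epsilon>) f z = (1
      + \<epsilon>) d z \<le> (1 + \<epsilon>) v\<close>. The excess \<open>w\<close> is thus
      disjoint from the exhausting family.\<close>
    define w where "w = pprt (u - (1 + \<epsilon>) *\<^sub>R j v)"
    have "w = 0"
    proof (rule Z(3)[rule_format])
      show "0 \<le> w" by (simp add: w_def)
      show "w \<le> u" using u0 v0 \<epsilon> by (simp add: w_def pprt_le_iff scaleR_nonneg_nonneg)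
      fix z assume z: "z \<in> Z"
      show "inf w (j z) = 0"
        unfolding w_def
      proof (rule inf_pprt_diff_eq_0)
        show "inf (pprt (u - (1 + \<epsilon>) *\<^sub>R j (f z))) (j z) = 0" by (rule f(2)[OF z])
        have "inf (f z - d z) z = 0" using d[OF z] by (simp add: is_band_projection_def)
        then have "inf (j (f z - d z)) (j z) = 0" by (simp del: j_simps(2) flip: j_inf)
        then have "inf ((1 + \<epsilon>) *\<^sub>R j (f z - d z)) (j z) = 0" using \<epsilon> by (intro inf_scaleR_eq_0) auto
        then show "inf ((1 + \<epsilon>) *\<^sub>R j (f z) - (1 + \<epsilon>) *\<^sub>R j (d z)) (j z) = 0"
          by (simp add: scaleR_diff_right)
        show "(1 + \<epsilon>) *\<^sub>R j (d z) \<le> (1 + \<epsilon>) *\<^sub>R j v"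
          using dv[OF z] \<epsilon> by (intro scaleR_left_mono) auto
      qed
    qed
    then have "u \<le> (1 + \<epsilon>) *\<^sub>R j v" by (simp add: w_def pprt_eq_0_iff)
    with au[OF a] have "j a \<le> j ((1 + \<epsilon>) *\<^sub>R v)" by (simp del: j_le_iff)
    then show ?thesis by (simp only: j_le_iff)
  qed
  ultimately show ?thesis by blast
qed

lemma (in universal_completion_embedding) disjointly_complete_imp_isLub:
  assumes compl: "complete (UNIV :: 'a set)" and dc: "disjointly_complete TYPE('a)"
    and A: "A \<subseteq> cball 0 1 \<inter> {0..}" "directed_by A (\<le>)" "bdd_above (j ` A)"
  shows "\<exists>s. isLub UNIV A s"
proof -
  define \<epsilon> where "\<epsilon> n = 1 / (real n + 1)" for n :: nat
  have \<epsilon>: "0 < \<epsilon> n" for n by (simp add: \<epsilon>_def)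
  obtain v where v_le: "\<And>n b. (\<forall>a\<in>A. a \<le> b) \<Longrightarrow> v n \<le> b"
    and A_le: "\<And>n a. a \<in> A \<Longrightarrow> a \<le> (1 + \<epsilon> n) *\<^sub>R v n"
    using ex_approximate_supremum[OF dc A \<epsilon>] by metis
  \<comment> \<open>Each \<open>(1 + \<epsilon> m) v m\<close> is an upper bound of
    \<open>A\<close>, hence above every other approximant.\<close>
  have vv: "v n \<le> (1 + \<epsilon> m) *\<^sub>R v m" for n m using A_le by (intro v_le) blast
  obtain a1 where a1: "a1 \<in> A" using A(2) by (auto simp: directed_by_def)
  have v0: "0 \<le> v n" for n
  proof -
    have "0 \<le> (1 + \<epsilon> n) *\<^sub>R v n" using A_le[OF a1, of n] a1 A(1) by (auto intro: order_trans)
    then show ?thesis using \<epsilon>[of n] by (simp add: zero_le_scaleR_iff)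
  qed
  have diff: "v n - v m \<le> (2 * \<epsilon> m) *\<^sub>R v 0" for n m
  proof -
    have "v n - v m \<le> \<epsilon> m *\<^sub>R v m" using vv[of n m] by (simp add: scaleR_add_left algebra_simps)
    \<comment> \<open>Because \<open>\<epsilon> 0 = 1\<close>, all approximants lie below
      \<open>2 v 0\<close>, which makes the estimate uniform.\<close>
    also have "\<dots> \<le> \<epsilon> m *\<^sub>R (2 *\<^sub>R v 0)"
      using vv[of m 0] \<epsilon>[of m] by (intro scaleR_left_mono) (auto simp: \<epsilon>_def[of 0])
    finally show ?thesis by (simp add: mult.commute)
  qed
  have ndiff: "norm (v n - v m) \<le> (2 * \<epsilon> m + 2 * \<epsilon> n) * norm (v 0)" for n m
  proof -
    have "\<bar>v n - v m\<bar> \<le> (2 * \<epsilon> m + 2 * \<epsilon> n) *\<^sub>R v 0"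
    proof (rule abs_leI)
      have "0 \<le> (2 * \<epsilon> k) *\<^sub>R v 0" for k using v0 \<epsilon>[of k] by (intro scaleR_nonneg_nonneg) auto
      then show "v n - v m \<le> (2 * \<epsilon> m + 2 * \<epsilon> n) *\<^sub>R v 0" "- (v n - v m) \<le> (2 * \<epsilon> m + 2 * \<epsilon> n) *\<^sub>R v 0"
        using diff[of n m] diff[of m n] by (simp_all add: scaleR_add_left add_increasing add_increasing2)
    qed
    then have "norm (v n - v m) \<le> norm ((2 * \<epsilon> m + 2 * \<epsilon> n) *\<^sub>R v 0)"
      by (intro norm_solid) (use abs_ge_self order_trans in blast)
    also have "\<dots> = (2 * \<epsilon> m + 2 * \<epsilon> n) * norm (v 0)" using \<epsilon>[of m] \<epsilon>[of n] by simp
    finally show ?thesis .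
  qed
  have \<epsilon>_lim: "\<epsilon> \<longlonglongrightarrow> 0" using LIMSEQ_inverse_real_of_nat by (simp add: \<epsilon>_def[abs_def] inverse_eq_divide add.commute)
  have "Cauchy v"
  proof (rule metric_CauchyI)
    fix r :: real assume r: "0 < r"
    have "(\<lambda>n. 4 * \<epsilon> n * norm (v 0)) \<longlonglongrightarrow> 4 * 0 * norm (v 0)"
      by (intro tendsto_intros \<epsilon>_lim)
    then have "\<forall>\<^sub>F n in sequentially. 4 * \<epsilon> n * norm (v 0) < r"
      using r by (intro order_tendstoD(2)) auto
    then obtain M where M: "4 * \<epsilon> M * norm (v 0) < r" by (auto simp: eventually_sequentially)
    have "dist (v m) (v n) < r" if "M \<le> m" "M \<le> n" for m n
    proof -
      have "\<epsilon> m \<le> \<epsilon> M" "\<epsilon> n \<le> \<epsilon> M" using that by (auto simp: \<epsilon>_def divide_simps)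
      then have "(2 * \<epsilon> n + 2 * \<epsilon> m) * norm (v 0) \<le> 4 * \<epsilon> M * norm (v 0)"
        by (intro mult_right_mono) auto
      with ndiff[of m n] M show ?thesis by (simp add: dist_norm)
    qed
    then show "\<exists>M. \<forall>m\<ge>M. \<forall>n\<ge>M. dist (v m) (v n) < r" by blast
  qed
  then obtain s where s: "v \<longlonglongrightarrow> s" using compl unfolding complete_def by auto
  have "a \<le> s" if "a \<in> A" for a
  proof -
    have "(\<lambda>n. (1 + \<epsilon> n) *\<^sub>R v n) \<longlonglongrightarrow> (1 + 0) *\<^sub>R s" by (intro tendsto_intros \<epsilon>_lim s)
    then show ?thesis
      using LIMSEQ_le_normed_lattice[OF tendsto_const _ A_le[OF that]] by simp
  qed
  moreover have "s \<le> b" if "\<forall>a\<in>A. a \<le> b" for b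
    using LIMSEQ_le_normed_lattice[OF s tendsto_const v_le[OF that]] by simp
  ultimately show ?thesis by (auto simp: isLub_UNIV_iff)
qed

section \<open>Monotone completeness\<close>

lemma directed_byD:
  assumes "directed_by P le" "p \<in> P" "q \<in> P"
  obtains r where "r \<in> P" "le p r" "le q r"
  using assms unfolding directed_by_def by blast

lemma directed_by_refl: "directed_by P le \<Longrightarrow> p \<in> P \<Longrightarrow> le p p"
  unfolding directed_by_def by (meson reflp_onD)

lemma directed_by_trans:
  "directed_by P le \<Longrightarrow> p \<in> P \<Longrightarrow> q \<in> P \<Longrightarrow> r \<in> P \<Longrightarrow> le p q \<Longrightarrow> le q r \<Longrightarrow> le p r"
  unfolding directed_by_def by (meson transp_onD)

lemma directed_by_orderI:
  fixes A :: "'a::order set"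
  assumes "A \<noteq> {}" "\<And>a b. a \<in> A \<Longrightarrow> b \<in> A \<Longrightarrow> \<exists>c\<in>A. a \<le> c \<and> b \<le> c"
  shows "directed_by A (\<le>)"
  using assms by (auto simp: directed_by_def intro!: reflp_onI transp_onI)

text \<open>The positive lower bounds of \<open>S\<close> are closed under joins and norm bounded by
  any member of \<open>S\<close>, so they have a supremum. An arbitrary lower bound \<open>b\<close>
  is covered through \<open>sup b 0\<close>.\<close>

lemma monotonically_complete_ex_glb:
  fixes S :: "'a::normed_lattice set"
  assumes mc: "monotonically_complete TYPE('a)" and S: "S \<noteq> {}" "S \<subseteq> {0..}"
  shows "\<exists>h. isGlb UNIV S h"
proof -
  define L where "L = {l. 0 \<le> l \<and> (\<forall>s\<in>S. l \<le> s)}"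
  obtain s0 where s0: "s0 \<in> S" using S(1) by blast
  have "\<exists>h. isLub UNIV L h"
  proof (rule isLub_of_bounded_directed[OF mc])
    show "directed_by L (\<le>)"
    proof (rule directed_by_orderI)
      have "0 \<in> L" using S(2) by (auto simp: L_def)
      then show "L \<noteq> {}" by blast
      fix a b assume "a \<in> L" "b \<in> L"
      then show "\<exists>c\<in>L. a \<le> c \<and> b \<le> c"
        by (intro bexI[of _ "sup a b"]) (auto simp: L_def le_supI1)
    qed
    show "norm l \<le> norm s0" if "l \<in> L" for l
      using that s0 by (intro norm_mono) (auto simp: L_def)
  qed (auto simp: L_def)
  then obtain h where h: "isLub UNIV L h" ..
  have ub: "l \<le> h" if "l \<in> L" for l using h that by (auto simp: isLub_UNIV_iff)
  have "h \<le> s" if "s \<in> S" for s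
    using h that unfolding isLub_UNIV_iff by (simp add: L_def)
  moreover have "b \<le> h" if b: "\<forall>s\<in>S. b \<le> s" for b
  proof -
    have "sup b 0 \<in> L" using b S(2) by (auto simp: L_def)
    then show ?thesis using ub[of "sup b 0"] by simp
  qed
  ultimately show ?thesis unfolding isGlb_UNIV_iff by blast
qed

text \<open>The members above a fixed \<open>a0\<close>, translated by \<open>- a0\<close>, form a
  positive directed norm bounded set. By directedness they have, before translation, the same upper
  bounds as \<open>A\<close>.\<close>

lemma monotonically_complete_ex_lub:
  fixes A :: "'a::normed_lattice set"
  assumes mc: "monotonically_complete TYPE('a)" and dir: "directed_by A (\<le>)" and "bounded A"
  shows "\<exists>s. isLub UNIV A s"
proof -
  obtain C where C: "\<And>a. a \<in> A \<Longrightarrow> norm a \<le> C" using \<open>bounded A\<close> by (auto simp: bounded_iff)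
  obtain a0 where a0: "a0 \<in> A" using dir by (auto simp: directed_by_def)
  define B where "B = {a \<in> A. a0 \<le> a}"
  have "\<exists>s. isLub UNIV ((+) (- a0) ` B) s"
  proof (rule isLub_of_bounded_directed[OF mc])
    show "directed_by ((+) (- a0) ` B) (\<le>)"
    proof (rule directed_by_orderI)
      show "(+) (- a0) ` B \<noteq> {}" using a0 by (auto simp: B_def)
      fix a b assume "a \<in> (+) (- a0) ` B" "b \<in> (+) (- a0) ` B"
      then obtain a' b' where ab: "a = - a0 + a'" "b = - a0 + b'" "a' \<in> A" "b' \<in> A" "a0 \<le> a'"
        by (auto simp: B_def)
      obtain r where r: "r \<in> A" "a' \<le> r" "b' \<le> r" using directed_byD[OF dir ab(3,4)] .
      then have "r \<in> B" using ab(5) by (auto simp: B_def)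
      then show "\<exists>c\<in>(+) (- a0) ` B. a \<le> c \<and> b \<le> c"
        using r ab(1,2) by (intro bexI[of _ "- a0 + r"]) auto
    qed
    show "(+) (- a0) ` B \<subseteq> {0..}" by (auto simp: B_def)
    show "norm a \<le> norm a0 + C" if a: "a \<in> (+) (- a0) ` B" for a
    proof -
      obtain b where b: "b \<in> A" "a = - a0 + b" using a by (auto simp: B_def)
      have "norm a \<le> norm (- a0) + norm b" unfolding b(2) by (rule norm_triangle_ineq)
      then show ?thesis using C[OF b(1)] by simp
    qed
  qed
  then obtain s where "isLub UNIV ((+) (- a0) ` B) s" ..
  then have s: "isLub UNIV B (a0 + s)" using isLub_plus[of "- a0" B "a0 + s"] by simp
  have "a \<le> a0 + s" if a: "a \<in> A" for a
  proof -
    obtain r where r: "r \<in> A" "a \<le> r" "a0 \<le> r" using directed_byD[OF dir a a0] .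
    then have "r \<le> a0 + s" using s by (auto simp: isLub_UNIV_iff B_def)
    with r(2) show ?thesis by (rule order_trans)
  qed
  moreover have "a0 + s \<le> b" if "\<forall>a\<in>A. a \<le> b" for b
    using s that by (auto simp: isLub_UNIV_iff B_def)
  ultimately show ?thesis unfolding isLub_UNIV_iff by blast
qed

text \<open>The finite joins of \<open>D\<close> form a directed subset of the unit ball with the
  same upper bounds as \<open>D\<close>.\<close>

lemma monotonically_complete_imp_disjointly_complete:
  assumes mc: "monotonically_complete TYPE('a::normed_lattice)"
  shows "disjointly_complete TYPE('a)"
  unfolding disjointly_complete_def
proof (intro allI impI)
  fix D :: "'a set" assume D: "D \<noteq> {}" "D \<subseteq> {0..}" "finite_sups D \<subseteq> cball 0 1"
  have mem: "d \<in> finite_sups D" if "d \<in> D" for d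
    unfolding finite_sups_def using that by (intro CollectI exI[of _ "{d}"]) auto
  have "\<exists>s. isLub UNIV (finite_sups D) s"
  proof (rule isLub_of_bounded_directed[OF mc])
    show "directed_by (finite_sups D) (\<le>)"
    proof (rule directed_by_orderI)
      show "finite_sups D \<noteq> {}" using D(1) mem by blast
      fix a b assume "a \<in> finite_sups D" "b \<in> finite_sups D"
      then obtain S T where ST: "a = Sup_fin S" "finite S" "S \<noteq> {}" "S \<subseteq> D"
        "b = Sup_fin T" "finite T" "T \<noteq> {}" "T \<subseteq> D"
        unfolding finite_sups_def by blast
      then have "Sup_fin (S \<union> T) = sup a b" by (simp add: Sup_fin.union)
      then have "sup a b \<in> finite_sups D"
        unfolding finite_sups_def using ST by (intro CollectI exI[of _ "S \<union> T"]) auto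
      then show "\<exists>c\<in>finite_sups D. a \<le> c \<and> b \<le> c" by (rule bexI[rotated]) simp
    qed
    show "finite_sups D \<subseteq> {0..}"
    proof
      fix y assume "y \<in> finite_sups D"
      then obtain S where S: "y = Sup_fin S" "finite S" "S \<noteq> {}" "S \<subseteq> D"
        unfolding finite_sups_def by blast
      obtain t where t: "t \<in> S" using S(3) by blast
      then have "0 \<le> t" using S(4) D(2) by auto
      also have "t \<le> y" unfolding S(1) using S(2) t by (rule Sup_fin.coboundedI)
      finally show "y \<in> {0..}" by simp
    qed
    show "norm a \<le> 1" if "a \<in> finite_sups D" for a using that D(3) by auto
  qed
  then obtain s where s: "isLub UNIV (finite_sups D) s" ..
  have "d \<le> s" if "d \<in> D" for d using s mem[OF that] by (auto simp: isLub_UNIV_iff)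
  moreover have "s \<le> b" if b: "\<forall>d\<in>D. d \<le> b" for b
  proof -
    have "y \<le> b" if y: "y \<in> finite_sups D" for y
    proof -
      obtain S where S: "y = Sup_fin S" "finite S" "S \<noteq> {}" "S \<subseteq> D"
        using y unfolding finite_sups_def by blast
      then show ?thesis using b by (auto intro!: Sup_fin.boundedI)
    qed
    then show ?thesis using s by (auto simp: isLub_UNIV_iff)
  qed
  ultimately show "\<exists>s. isLub UNIV D s" unfolding isLub_UNIV_iff by blast
qed

text \<open>Amemiya's argument: weights tending to infinity leave the series rapidly convergent, and the
  supremum of the weighted partial sums controls the tails of the original series in norm.\<close>

lemma monotonically_complete_series_convergent:
  fixes y :: "nat \<Rightarrow> 'a::normed_lattice"
  assumes mc: "monotonically_complete TYPE('a)"
    and y0: "\<And>n. 0 \<le> y n" and ny: "\<And>n. norm (y n) \<le> (1 / 4) ^ n"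
  shows "convergent (\<lambda>k. \<Sum>i<k. y i)"
proof -
  have lub: "\<exists>s. isLub UNIV (range (\<lambda>k. \<Sum>i<k. x i)) s"
    if x: "\<And>n. 0 \<le> x n" "\<And>n. norm (x n) \<le> (1 / 2) ^ n" for x :: "nat \<Rightarrow> 'a"
  proof (rule isLub_of_bounded_directed[OF mc])
    show "directed_by (range (\<lambda>k. \<Sum>i<k. x i)) (\<le>)"
    proof (rule directed_by_orderI)
      fix a b assume "a \<in> range (\<lambda>k. \<Sum>i<k. x i)" "b \<in> range (\<lambda>k. \<Sum>i<k. x i)"
      then obtain k l where "a = (\<Sum>i<k. x i)" "b = (\<Sum>i<l. x i)" by blast
      then show "\<exists>c\<in>range (\<lambda>k. \<Sum>i<k. x i). a \<le> c \<and> b \<le> c"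
        using x(1) by (intro bexI[of _ "\<Sum>i<max k l. x i"] conjI) (auto intro!: sum_mono2)
    qed simp
    show "range (\<lambda>k. \<Sum>i<k. x i) \<subseteq> {0..}" using x(1) by (auto intro: sum_nonneg)
    fix a assume "a \<in> range (\<lambda>k. \<Sum>i<k. x i)"
    then obtain k where a: "a = (\<Sum>i<k. x i)" by blast
    have "norm a \<le> (\<Sum>i<k. (1 / 2) ^ i)" unfolding a using x(2) by (intro sum_norm_le) auto
    also have "\<dots> = 2 - 2 * (1 / 2) ^ k" by (induction k) auto
    also have "\<dots> \<le> (2::real)" by simp
    finally show "norm a \<le> 2" .
  qed
  have ny2: "norm (y n) \<le> (1 / 2) ^ n" for n
  proof -
    have "(1 / 4 :: real) ^ n \<le> (1 / 2) ^ n" by (intro power_mono) auto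
    with ny[of n] show ?thesis by linarith
  qed
  obtain s where s: "isLub UNIV (range (\<lambda>k. \<Sum>i<k. y i)) s" using lub[OF y0 ny2] by blast
  \<comment> \<open>The bound \<open>(1 / 4) ^ n\<close> leaves room for the weight
    \<open>2 ^ n\<close>: the weighted terms still have norms at most
    \<open>(1 / 2) ^ n\<close>.\<close>
  define x where "x n = 2 ^ n *\<^sub>R y n" for n
  have x0: "0 \<le> x n" for n using y0 by (simp add: x_def scaleR_nonneg_nonneg)
  have nx: "norm (x n) \<le> (1 / 2) ^ n" for n
  proof -
    have "norm (x n) = 2 ^ n * norm (y n)" by (simp add: x_def)
    also have "\<dots> \<le> 2 ^ n * (1 / 4) ^ n" using ny by (intro mult_left_mono) auto
    also have "\<dots> = (1 / 2) ^ n" by (simp flip: power_mult_distrib)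
    finally show ?thesis .
  qed
  obtain t where t: "isLub UNIV (range (\<lambda>k. \<Sum>i<k. x i)) t" using lub[OF x0 nx] by blast
  have tk: "(\<Sum>i<k. x i) \<le> t" and sk: "(\<Sum>i<k. y i) \<le> s" for k
    using s t by (auto simp: isLub_UNIV_iff)
  have tail: "s - (\<Sum>i<k. y i) \<le> (1 / 2) ^ k *\<^sub>R t" for k
  proof -
    \<comment> \<open>Terms with index below \<open>k\<close> are covered by the first sum. For
      \<open>m \<ge> k\<close>, the term \<open>y m\<close> is
      \<open>(1 / 2) ^ m *\<^sub>R x m\<close>, which is at most
      \<open>(1 / 2) ^ k *\<^sub>R x m\<close>.\<close>
    have partial: "(\<Sum>i<m. y i) \<le> (\<Sum>i<k. y i) + (1 / 2) ^ k *\<^sub>R (\<Sum>i<m. x i)" for m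
    proof (induction m)
      case 0
      then show ?case using y0 by (simp add: sum_nonneg)
    next
      case (Suc m)
      show ?case
      proof (cases "m < k")
        case True
        then have "(\<Sum>i<Suc m. y i) \<le> (\<Sum>i<k. y i)" using y0 by (intro sum_mono2) auto
        moreover have "0 \<le> (1 / 2) ^ k *\<^sub>R (\<Sum>i<Suc m. x i)"
          using x0 by (intro scaleR_nonneg_nonneg sum_nonneg) auto
        ultimately show ?thesis by (rule add_increasing2[rotated])
      next
        case False
        have "y m = (1 / 2) ^ m *\<^sub>R x m" by (simp add: x_def flip: power_mult_distrib)
        also have "\<dots> \<le> (1 / 2) ^ k *\<^sub>R x m"
          using False x0 by (intro scaleR_right_mono power_decreasing) auto
        finally show ?thesis using Suc by (simp add: scaleR_add_right add.assoc[symmetric] add_mono)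
      qed
    qed
    have "(\<Sum>i<m. y i) \<le> (\<Sum>i<k. y i) + (1 / 2) ^ k *\<^sub>R t" for m
    proof -
      have "(1 / 2) ^ k *\<^sub>R (\<Sum>i<m. x i) \<le> (1 / 2) ^ k *\<^sub>R t"
        using tk by (intro scaleR_left_mono) auto
      with partial[of m] show ?thesis by (meson add_left_mono order_trans)
    qed
    then have "s \<le> (\<Sum>i<k. y i) + (1 / 2) ^ k *\<^sub>R t" using s by (auto simp: isLub_UNIV_iff)
    then show ?thesis by (simp add: algebra_simps)
  qed
  have "(\<lambda>k. \<Sum>i<k. y i) \<longlonglongrightarrow> s"
  proof (rule LIMSEQ_I)
    fix r :: real assume "0 < r"
    have "(\<lambda>k. (1 / 2) ^ k * norm t) \<longlonglongrightarrow> 0 * norm t"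
      by (intro tendsto_intros LIMSEQ_power_zero) simp
    then have "\<forall>\<^sub>F k in sequentially. (1 / 2) ^ k * norm t < r"
      using \<open>0 < r\<close> by (intro order_tendstoD(2)) auto
    then obtain N where N: "\<And>k. k \<ge> N \<Longrightarrow> (1 / 2) ^ k * norm t < r"
      by (auto simp: eventually_sequentially)
    have "norm ((\<Sum>i<k. y i) - s) < r" if "k \<ge> N" for k
    proof -
      have "norm (s - (\<Sum>i<k. y i)) \<le> norm ((1 / 2) ^ k *\<^sub>R t)"
        using sk[of k] tail[of k] by (intro norm_mono) auto
      then show ?thesis using N[OF that] by (simp add: norm_minus_commute)
    qed
    then show "\<exists>N. \<forall>k\<ge>N. norm ((\<Sum>i<k. y i) - s) < r" by blast
  qed
  then show ?thesis by (rule convergentI)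
qed

text \<open>A Cauchy sequence has a subsequence with geometrically small increments. The positive
  and the negative parts of these increments have convergent series, so the subsequence converges,
  and with it the whole sequence.\<close>

lemma monotonically_complete_imp_complete:
  assumes mc: "monotonically_complete TYPE('a::normed_lattice)"
  shows "complete (UNIV :: 'a set)"
  unfolding complete_def
proof (intro allI impI)
  fix x :: "nat \<Rightarrow> 'a" assume "(\<forall>n. x n \<in> UNIV) \<and> Cauchy x"
  then have x: "Cauchy x" by simp
  have "\<forall>k. \<exists>N. \<forall>m\<ge>N. \<forall>n\<ge>N. dist (x m) (x n) < (1 / 4) ^ k"
    using metric_CauchyD[OF x] by simp
  from choice[OF this] obtain N where
    N: "\<And>k m n. m \<ge> N k \<Longrightarrow> n \<ge> N k \<Longrightarrow> dist (x m) (x n) < (1 / 4) ^ k"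
    by blast
  \<comment> \<open>The sum guarantees \<open>r k \<ge> N k\<close>, and the summand
    \<open>k\<close> makes \<open>r\<close> strictly increasing.\<close>
  define r where "r k = (\<Sum>i\<le>k. N i) + k" for k
  have r: "strict_mono r" by (auto simp: strict_mono_Suc_iff r_def)
  have rN: "N k \<le> r k" for k
  proof -
    have "N k \<le> (\<Sum>i\<le>k. N i)" by (rule member_le_sum) auto
    then show ?thesis by (simp add: r_def)
  qed
  define d where "d k = x (r (Suc k)) - x (r k)" for k
  have nd: "norm (d k) \<le> (1 / 4) ^ k" for k
  proof -
    have "N k \<le> r (Suc k)" using rN[of k] strict_monoD[OF r, of k "Suc k"] by simp
    then show ?thesis using N[OF _ rN[of k], of "r (Suc k)"] by (simp add: d_def dist_norm)
  qed
  have "norm (pprt (d k)) \<le> (1 / 4) ^ k" "norm (pprt (- d k)) \<le> (1 / 4) ^ k" for k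
    using norm_pprt_le[of "d k"] norm_pprt_le[of "- d k"] nd[of k] by simp_all
  then have "convergent (\<lambda>k. \<Sum>i<k. pprt (d i))" "convergent (\<lambda>k. \<Sum>i<k. pprt (- d i))"
    by (intro monotonically_complete_series_convergent[OF mc] zero_le_pprt; blast)+
  then obtain a b where ab: "(\<lambda>k. \<Sum>i<k. pprt (d i)) \<longlonglongrightarrow> a" "(\<lambda>k. \<Sum>i<k. pprt (- d i)) \<longlonglongrightarrow> b"
    by (auto simp: convergent_def)
  have "x (r k) = x (r 0) + ((\<Sum>i<k. pprt (d i)) - (\<Sum>i<k. pprt (- d i)))" for k
  proof (induction k)
    case (Suc k)
    have "pprt (d k) - pprt (- d k) = d k" using prts[of "d k"] by (simp add: pprt_neg)
    then have "x (r (Suc k)) = x (r k) + (pprt (d k) - pprt (- d k))" by (simp add: d_def)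
    then show ?case using Suc by simp
  qed simp
  then have eq: "x \<circ> r = (\<lambda>k. x (r 0) + ((\<Sum>i<k. pprt (d i)) - (\<Sum>i<k. pprt (- d i))))"
    unfolding comp_def by (rule ext)
  have "(x \<circ> r) \<longlonglongrightarrow> x (r 0) + (a - b)"
    unfolding eq by (intro tendsto_intros ab)
  then show "\<exists>l\<in>UNIV. x \<longlonglongrightarrow> l" using Cauchy_converges_subseq[OF x r] by blast
qed

section \<open>Order convergence and unbounded order convergence\<close>

lemma decreases_to_zeroD:
  assumes "decreases_to_zero Q"
  shows "Q \<noteq> {}" "\<And>q. q \<in> Q \<Longrightarrow> 0 \<le> q" "\<And>l. (\<And>q. q \<in> Q \<Longrightarrow> l \<le> q) \<Longrightarrow> l \<le> 0"
  using assms by (auto simp: decreases_to_zero_def directed_by_def isGlb_UNIV_iff)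

lemma decreases_to_zeroI:
  fixes Q :: "'a::vector_lattice set"
  assumes "Q \<noteq> {}" "\<And>a b. a \<in> Q \<Longrightarrow> b \<in> Q \<Longrightarrow> \<exists>c\<in>Q. c \<le> a \<and> c \<le> b"
    and "\<And>q. q \<in> Q \<Longrightarrow> 0 \<le> q" "\<And>l. (\<And>q. q \<in> Q \<Longrightarrow> l \<le> q) \<Longrightarrow> l \<le> 0"
  shows "decreases_to_zero Q"
  using assms unfolding decreases_to_zero_def directed_by_def isGlb_UNIV_iff
  by (auto intro!: reflp_onI transp_onI)

text \<open>This absorbs the sum of the errors for positive and negative parts. Half of a lower
  bound of the doubled set is a lower bound of \<open>Q\<close>.\<close>

lemma decreases_to_zero_double:
  fixes Q :: "'a::vector_lattice set"
  assumes Q: "decreases_to_zero Q"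
  shows "decreases_to_zero ((\<lambda>q. q + q) ` Q)"
proof (rule decreases_to_zeroI)
  show "(\<lambda>q. q + q) ` Q \<noteq> {}" using decreases_to_zeroD(1)[OF Q] by simp
  fix a b assume "a \<in> (\<lambda>q. q + q) ` Q" "b \<in> (\<lambda>q. q + q) ` Q"
  then obtain p q where pq: "p \<in> Q" "a = p + p" "q \<in> Q" "b = q + q" by blast
  then obtain r where "r \<in> Q" "r \<le> p" "r \<le> q"
    using Q directed_byD[of Q "(\<ge>)" p q] unfolding decreases_to_zero_def by blast
  then show "\<exists>c\<in>(\<lambda>q. q + q) ` Q. c \<le> a \<and> c \<le> b"
    using pq by (intro bexI[of _ "r + r"]) (auto intro: add_mono)
next
  fix q assume "q \<in> (\<lambda>q. q + q) ` Q"
  then show "0 \<le> q" using decreases_to_zeroD(2)[OF Q] by auto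
next
  fix l assume l: "\<And>q. q \<in> (\<lambda>q. q + q) ` Q \<Longrightarrow> l \<le> q"
  have "(1 / 2) *\<^sub>R l \<le> 0"
  proof (rule decreases_to_zeroD(3)[OF Q])
    fix q assume "q \<in> Q"
    then have "l \<le> 2 *\<^sub>R q" using l by (simp add: scaleR_2)
    then have "(1 / 2) *\<^sub>R l \<le> (1 / 2) *\<^sub>R (2 *\<^sub>R q)" by (rule scaleR_left_mono) simp
    then show "(1 / 2) *\<^sub>R l \<le> q" by simp
  qed
  then show "l \<le> 0" by (simp add: scaleR_le_0_iff)
qed

lemma uo_converges_iff:
  "uo_converges P le f g \<longleftrightarrow> (\<forall>e\<ge>0. \<exists>Q. decreases_to_zero Q \<and>
     (\<forall>q\<in>Q. \<exists>p0\<in>P. \<forall>p\<in>P. le p0 p \<longrightarrow> inf \<bar>f p - g\<bar> e \<le> q))"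
  unfolding uo_converges_def order_converges_def by simp

text \<open>Directedness replaces the pair of thresholds of the product order by a single
  one.\<close>

lemma uo_Cauchy_iff:
  assumes dir: "directed_by P le"
  shows "uo_Cauchy P le f \<longleftrightarrow> (\<forall>e\<ge>0. \<exists>Q. decreases_to_zero Q \<and>
     (\<forall>q\<in>Q. \<exists>p0\<in>P. \<forall>p\<in>P. \<forall>r\<in>P. le p0 p \<longrightarrow> le p0 r \<longrightarrow> inf \<bar>f p - f r\<bar> e \<le> q))"
proof -
  have "(\<exists>u\<in>P \<times> P. \<forall>v\<in>P \<times> P. rel_prod le le u v \<longrightarrow> inf \<bar>(case v of (p, r) \<Rightarrow> f p - f r) - 0\<bar> e \<le> q) \<longleftrightarrow>
      (\<exists>p0\<in>P. \<forall>p\<in>P. \<forall>r\<in>P. le p0 p \<longrightarrow> le p0 r \<longrightarrow> inf \<bar>f p - f r\<bar> e \<le> q)" (is "?L \<longleftrightarrow> ?R") for e q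
  proof
    assume ?L
    then obtain a b where ab: "a \<in> P" "b \<in> P"
      and *: "\<forall>p\<in>P. \<forall>r\<in>P. le a p \<longrightarrow> le b r \<longrightarrow> inf \<bar>f p - f r\<bar> e \<le> q"
      by auto
    obtain c where c: "c \<in> P" "le a c" "le b c" using directed_byD[OF dir ab] .
    have "inf \<bar>f p - f r\<bar> e \<le> q" if "p \<in> P" "r \<in> P" "le c p" "le c r" for p r
      using * that directed_by_trans[OF dir ab(1) c(1) that(1) c(2) that(3)]
        directed_by_trans[OF dir ab(2) c(1) that(2) c(3) that(4)] by blast
    then show ?R using c(1) by blast
  next
    assume ?R
    then obtain p0 where p0: "p0 \<in> P"
      "\<forall>p\<in>P. \<forall>r\<in>P. le p0 p \<longrightarrow> le p0 r \<longrightarrow> inf \<bar>f p - f r\<bar> e \<le> q" by blast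
    then show ?L by (intro bexI[of _ "(p0, p0)"]) auto
  qed
  then show ?thesis unfolding uo_Cauchy_def uo_converges_iff by simp
qed

section \<open>Positive parts and limits inferior of nets\<close>

lemma pprt_diff_abs_le: "\<bar>pprt a - pprt b\<bar> \<le> \<bar>a - b\<bar>" for a :: "'a::lattice_ab_group_add_abs"
proof -
  have *: "pprt a - pprt b \<le> \<bar>a - b\<bar>" for a b :: 'a
  proof -
    have "a \<le> b + \<bar>a - b\<bar>" using abs_ge_self[of "a - b"] by (simp add: algebra_simps)
    also have "\<dots> \<le> pprt b + \<bar>a - b\<bar>" by (intro add_right_mono le_pprt)
    finally show ?thesis by (simp add: diff_le_eq pprt_le_iff add.commute)
  qed
  show ?thesis using *[of a b] *[of b a] by (intro abs_leI) (simp_all add: abs_minus_commute)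
qed

lemma order_converges_pprt:
  assumes "order_converges P le f g"
  shows "order_converges P le (\<lambda>p. pprt (f p)) (pprt g)"
proof -
  obtain Q where Q: "decreases_to_zero Q" "\<forall>q\<in>Q. \<exists>p0\<in>P. \<forall>p\<in>P. le p0 p \<longrightarrow> \<bar>f p - g\<bar> \<le> q"
    using assms unfolding order_converges_def by blast
  have "\<forall>q\<in>Q. \<exists>p0\<in>P. \<forall>p\<in>P. le p0 p \<longrightarrow> \<bar>pprt (f p) - pprt g\<bar> \<le> q"
    using Q(2) by (meson order_trans pprt_diff_abs_le)
  with Q(1) show ?thesis unfolding order_converges_def by blast
qed

lemma order_converges_uminus:
  assumes "order_converges P le f g"
  shows "order_converges P le (\<lambda>p. - f p) (- g)"
  using assms unfolding order_converges_def by (simp add: abs_minus_commute)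

text \<open>The tail infima \<open>h p\<close> exist by positivity, increase along the net and have
  norm at most \<open>C\<close>. Their supremum \<open>s\<close> is the limit inferior.\<close>

lemma monotonically_complete_liminf:
  fixes f :: "'i \<Rightarrow> 'a::normed_lattice"
  assumes mc: "monotonically_complete TYPE('a)" and dir: "directed_by P le"
    and f: "\<And>p. p \<in> P \<Longrightarrow> 0 \<le> f p" "\<And>p. p \<in> P \<Longrightarrow> norm (f p) \<le> C"
  shows "\<exists>h s. (\<forall>p\<in>P. isGlb UNIV (f ` {r \<in> P. le p r}) (h p)) \<and> isLub UNIV (h ` P) s"
proof -
  have "\<exists>h. isGlb UNIV (f ` {r \<in> P. le p r}) h" if "p \<in> P" for p
    using f(1) directed_by_refl[OF dir that] that by (intro monotonically_complete_ex_glb[OF mc]) auto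
  then obtain h where h: "\<And>p. p \<in> P \<Longrightarrow> isGlb UNIV (f ` {r \<in> P. le p r}) (h p)" by metis
  have h_le: "h p \<le> f r" if "p \<in> P" "r \<in> P" "le p r" for p r
    using h[OF that(1)] that by (auto simp: isGlb_UNIV_iff)
  have le_h: "b \<le> h p" if "p \<in> P" "\<And>r. r \<in> P \<Longrightarrow> le p r \<Longrightarrow> b \<le> f r" for b p
    using h[OF that(1)] that(2) by (auto simp: isGlb_UNIV_iff)
  have h0: "0 \<le> h p" if "p \<in> P" for p using that f(1) by (intro le_h) auto
  have "\<exists>s. isLub UNIV (h ` P) s"
  proof (rule isLub_of_bounded_directed[OF mc])
    show "directed_by (h ` P) (\<le>)"
    proof (rule directed_by_orderI)
      show "h ` P \<noteq> {}" using dir by (auto simp: directed_by_def)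
      fix a b assume "a \<in> h ` P" "b \<in> h ` P"
      then obtain p q where pq: "p \<in> P" "q \<in> P" "a = h p" "b = h q" by blast
      obtain r where r: "r \<in> P" "le p r" "le q r" using directed_byD[OF dir pq(1,2)] .
      have "h p' \<le> h r" if "p' \<in> P" "le p' r" for p'
        using that r(1) directed_by_trans[OF dir that(1) r(1) _ that(2)] by (intro le_h h_le) auto
      then show "\<exists>c\<in>h ` P. a \<le> c \<and> b \<le> c" using r pq by blast
    qed
    show "h ` P \<subseteq> {0..}" using h0 by auto
    fix a assume "a \<in> h ` P"
    then obtain p where p: "p \<in> P" "a = h p" by blast
    have "norm (h p) \<le> norm (f p)"
      using h0[OF p(1)] h_le[OF p(1) p(1) directed_by_refl[OF dir p(1)]] by (rule norm_mono)
    then show "norm a \<le> C" using f(2)[OF p(1)] p(2) by simp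
  qed
  then show ?thesis using h by blast
qed

text \<open>A truncated estimate between late members of the net survives passage to the limit
  inferior. From above, the infimum of the tail at \<open>p0\<close> is used; from below, each
  \<open>h r\<close> lies under some \<open>f r'\<close> with \<open>r'\<close> beyond
  \<open>p0\<close>.\<close>

lemma liminf_close:
  fixes f :: "'i \<Rightarrow> 'a::vector_lattice"
  assumes dir: "directed_by P le"
    and tails: "\<forall>p\<in>P. isGlb UNIV (f ` {r \<in> P. le p r}) (h p)" and s: "isLub UNIV (h ` P) s"
    and p0: "p0 \<in> P"
    and close: "\<And>p r. p \<in> P \<Longrightarrow> r \<in> P \<Longrightarrow> le p0 p \<Longrightarrow> le p0 r \<Longrightarrow> inf \<bar>f p - f r\<bar> e \<le> q"
    and e: "0 \<le> e" and q: "0 \<le> q" and p: "p \<in> P" "le p0 p"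
  shows "inf \<bar>f p - s\<bar> e \<le> q"
proof -
  note h = tails[rule_format]
  have close1: "inf (f p' - f r') e \<le> q" if "p' \<in> P" "r' \<in> P" "le p0 p'" "le p0 r'" for p' r'
    using close[OF that] inf_abs_le_iff[OF e q] by blast
  have "inf (f p - h p0) e \<le> q"
    using p by (intro isGlb_inf_diff_le[OF h[OF p0]]) (auto intro: close1)
  moreover have "h p0 \<le> s" using s p0 by (auto simp: isLub_UNIV_iff)
  then have "inf (f p - s) e \<le> inf (f p - h p0) e" by (intro inf_mono diff_left_mono) auto
  ultimately have 1: "inf (f p - s) e \<le> q" by (rule order_trans[rotated])
  have 2: "inf (s - f p) e \<le> q"
  proof (rule isLub_inf_diff_le[OF s])
    fix a assume "a \<in> h ` P"
    then obtain r where r: "r \<in> P" "a = h r" by blast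
    obtain r' where r': "r' \<in> P" "le r r'" "le p0 r'" using directed_byD[OF dir r(1) p0] .
    have "h r \<le> f r'" using h[OF r(1)] r' by (auto simp: isGlb_UNIV_iff)
    then have "inf (a - f p) e \<le> inf (f r' - f p) e"
      unfolding r(2) by (intro inf_mono diff_right_mono) auto
    also have "\<dots> \<le> q" using close1 r' p by blast
    finally show "inf (a - f p) e \<le> q" .
  qed
  show ?thesis using 1 2 inf_abs_le_iff[OF e q, of "f p - s"] by simp
qed

text \<open>The limit is the difference of the limits inferior of the positive and negative parts.
  These are chosen before \<open>e\<close>, so the same limit serves every truncation; the two
  errors add up to \<open>q + q\<close>.\<close>

lemma monotonically_complete_uo_Cauchy:
  fixes f :: "'i \<Rightarrow> 'a::normed_lattice"
  assumes mc: "monotonically_complete TYPE('a)" and dir: "directed_by P le"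
    and f: "f ` P \<subseteq> cball 0 1" and Cauchy: "uo_Cauchy P le f"
  shows "\<exists>g. uo_converges P le f g"
proof -
  have nf: "norm (f p) \<le> 1" if "p \<in> P" for p using f that by auto
  have n1: "norm (pprt (f p)) \<le> 1" if "p \<in> P" for p
    using norm_pprt_le[of "f p"] nf[OF that] by simp
  have n2: "norm (pprt (- f p)) \<le> 1" if "p \<in> P" for p
    using norm_pprt_le[of "- f p"] nf[OF that] by simp
  obtain h1 s1 where 1: "\<forall>p\<in>P. isGlb UNIV ((\<lambda>p. pprt (f p)) ` {r \<in> P. le p r}) (h1 p)"
    "isLub UNIV (h1 ` P) s1"
    using monotonically_complete_liminf[OF mc dir, of "\<lambda>p. pprt (f p)" 1, OF zero_le_pprt n1] by blast
  obtain h2 s2 where 2: "\<forall>p\<in>P. isGlb UNIV ((\<lambda>p. pprt (- f p)) ` {r \<in> P. le p r}) (h2 p)"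
    "isLub UNIV (h2 ` P) s2"
    using monotonically_complete_liminf[OF mc dir, of "\<lambda>p. pprt (- f p)" 1, OF zero_le_pprt n2] by blast
  have "\<exists>Q. decreases_to_zero Q \<and> (\<forall>q\<in>Q. \<exists>p0\<in>P. \<forall>p\<in>P. le p0 p \<longrightarrow> inf \<bar>f p - (s1 - s2)\<bar> e \<le> q)"
    if e: "0 \<le> e" for e
  proof -
    obtain Q where Q: "decreases_to_zero Q"
      and close: "\<And>q. q \<in> Q \<Longrightarrow> \<exists>p0\<in>P. \<forall>p\<in>P. \<forall>r\<in>P. le p0 p \<longrightarrow> le p0 r \<longrightarrow> inf \<bar>f p - f r\<bar> e \<le> q"
      using Cauchy e unfolding uo_Cauchy_iff[OF dir] by blast
    have "\<exists>p0\<in>P. \<forall>p\<in>P. le p0 p \<longrightarrow> inf \<bar>f p - (s1 - s2)\<bar> e \<le> q + q" if q: "q \<in> Q" for q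
    proof -
      obtain p0 where p0: "p0 \<in> P"
        and c: "\<And>p r. p \<in> P \<Longrightarrow> r \<in> P \<Longrightarrow> le p0 p \<Longrightarrow> le p0 r \<Longrightarrow> inf \<bar>f p - f r\<bar> e \<le> q"
        using close[OF q] by blast
      have q0: "0 \<le> q" using decreases_to_zeroD(2)[OF Q q] .
      have c1: "inf \<bar>pprt (f p) - pprt (f r)\<bar> e \<le> q"
        if "p \<in> P" "r \<in> P" "le p0 p" "le p0 r" for p r
        using inf_mono[OF pprt_diff_abs_le[of "f p" "f r"] order_refl[of e]] c[OF that] by (rule order_trans)
      have c2: "inf \<bar>pprt (- f p) - pprt (- f r)\<bar> e \<le> q"
        if "p \<in> P" "r \<in> P" "le p0 p" "le p0 r" for p r
      proof -
        have "\<bar>- f p - - f r\<bar> = \<bar>f p - f r\<bar>" by (simp add: abs_minus_commute)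
        then have "\<bar>pprt (- f p) - pprt (- f r)\<bar> \<le> \<bar>f p - f r\<bar>"
          using pprt_diff_abs_le[of "- f p" "- f r"] by (simp only:)
        from inf_mono[OF this order_refl[of e]] c[OF that] show ?thesis by (rule order_trans)
      qed
      have "inf \<bar>f p - (s1 - s2)\<bar> e \<le> q + q" if p: "p \<in> P" "le p0 p" for p
      proof -
        have "f p - (s1 - s2) = (pprt (f p) - s1) - (pprt (- f p) - s2)"
          using prts[of "f p"] by (simp add: pprt_neg algebra_simps)
        then have "\<bar>f p - (s1 - s2)\<bar> \<le> \<bar>pprt (f p) - s1\<bar> + \<bar>pprt (- f p) - s2\<bar>"
          using abs_triangle_ineq4[of "pprt (f p) - s1" "pprt (- f p) - s2"] by (simp only:)
        then have "inf \<bar>f p - (s1 - s2)\<bar> e \<le> inf (\<bar>pprt (f p) - s1\<bar> + \<bar>pprt (- f p) - s2\<bar>) e"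
          by (intro inf_mono) auto
        also have "\<dots> \<le> inf \<bar>pprt (f p) - s1\<bar> e + inf \<bar>pprt (- f p) - s2\<bar> e"
          using e by (intro inf_add_le) auto
        also have "\<dots> \<le> q + q"
          by (intro add_mono liminf_close[OF dir 1 p0 c1 e q0 p] liminf_close[OF dir 2 p0 c2 e q0 p])
        finally show ?thesis .
      qed
      then show ?thesis using p0 by blast
    qed
    then show ?thesis
      using decreases_to_zero_double[OF Q] by (intro exI[of _ "(\<lambda>q. q + q) ` Q"]) auto
  qed
  then show ?thesis unfolding uo_converges_iff by blast
qed

lemma isLub_of_uo_limit:
  fixes f :: "'i \<Rightarrow> 'a::vector_lattice"
  assumes dir: "directed_by P (\<lambda>p q. f p \<le> f q)" and lim: "uo_converges P (\<lambda>p q. f p \<le> f q) f s"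
  shows "isLub UNIV (f ` P) s"
proof -
  \<comment> \<open>If \<open>e\<close> stays below the distance to \<open>s\<close> at indices
    arbitrarily far out, truncation by \<open>e\<close> returns \<open>e\<close> there, so
    \<open>e\<close> is below every member of \<open>Q\<close>. This is applied to the positive
    parts of \<open>f a - s\<close> and of \<open>s - b\<close>.\<close>
  have zero: "e \<le> 0" if e: "0 \<le> e" and below: "\<And>p0. p0 \<in> P \<Longrightarrow> \<exists>p\<in>P. f p0 \<le> f p \<and> e \<le> \<bar>f p - s\<bar>" for e
  proof -
    obtain Q where Q: "decreases_to_zero Q"
      "\<forall>q\<in>Q. \<exists>p0\<in>P. \<forall>p\<in>P. f p0 \<le> f p \<longrightarrow> inf \<bar>f p - s\<bar> e \<le> q"
      using lim e unfolding uo_converges_iff by blast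
    show ?thesis
    proof (rule decreases_to_zeroD(3)[OF Q(1)])
      fix q assume "q \<in> Q"
      then obtain p0 where p0: "p0 \<in> P" "\<forall>p\<in>P. f p0 \<le> f p \<longrightarrow> inf \<bar>f p - s\<bar> e \<le> q" using Q(2) by blast
      obtain p where "p \<in> P" "f p0 \<le> f p" "e \<le> \<bar>f p - s\<bar>" using below[OF p0(1)] by blast
      then show "e \<le> q" using p0(2) by (auto simp: inf_absorb2)
    qed
  qed
  have "f a \<le> s" if a: "a \<in> P" for a
  proof -
    have "pprt (f a - s) \<le> 0"
    proof (rule zero)
      fix p0 assume p0: "p0 \<in> P"
      obtain p where p: "p \<in> P" "f p0 \<le> f p" "f a \<le> f p" using directed_byD[OF dir p0 a] .
      have "f a - s \<le> f p - s" using p(3) by (rule diff_right_mono)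
      also have "\<dots> \<le> \<bar>f p - s\<bar>" by (rule abs_ge_self)
      finally show "\<exists>p\<in>P. f p0 \<le> f p \<and> pprt (f a - s) \<le> \<bar>f p - s\<bar>"
        using p by (intro bexI[of _ p]) (auto simp: pprt_le_iff)
    qed simp
    then show ?thesis by (simp add: pprt_le_iff)
  qed
  moreover have "s \<le> b" if b: "\<forall>a\<in>f ` P. a \<le> b" for b
  proof -
    have "pprt (s - b) \<le> 0"
    proof (rule zero)
      fix p assume p: "p \<in> P"
      have "s - b \<le> - (f p - s)" using b p by (simp add: diff_left_mono)
      also have "\<dots> \<le> \<bar>f p - s\<bar>" by (rule abs_ge_minus_self)
      finally show "\<exists>r\<in>P. f p \<le> f r \<and> pprt (s - b) \<le> \<bar>f r - s\<bar>"
        using p by (intro bexI[of _ p]) (auto simp: pprt_le_iff)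
    qed simp
    then show ?thesis by (simp add: pprt_le_iff)
  qed
  ultimately show ?thesis by (auto simp: isLub_UNIV_iff)
qed

text \<open>This turns a directed set of values into a directed index set of a net:
  \<open>\<iota>\<close> places a value in the index type and \<open>v\<close> recovers it.\<close>

lemma directed_by_pullback:
  fixes A :: "'a::order set"
  assumes "directed_by A (\<le>)" "\<And>a. v (\<iota> a) = a"
  shows "directed_by (\<iota> ` A) (\<lambda>p q. v p \<le> v q)"
  using assms unfolding directed_by_def by (auto intro!: reflp_onI transp_onI)

section \<open>Order adherence and uo-Cauchy nets under the embedding\<close>

context universal_completion_embedding
begin

text \<open>The limit is the image of the limit inferior. Eventually \<open>j (F p)\<close> lies
  between \<open>g - q\<close> and \<open>g + q\<close>, and since \<open>j\<close> preserves infima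
  and suprema, these bounds pass to \<open>j s\<close>.\<close>

lemma positive_order_limit_in_range:
  fixes F :: "'i \<Rightarrow> 'a"
  assumes mc: "monotonically_complete TYPE('a)" and dir: "directed_by P le"
    and F: "\<And>p. p \<in> P \<Longrightarrow> 0 \<le> F p" "\<And>p. p \<in> P \<Longrightarrow> norm (F p) \<le> C"
    and lim: "order_converges P le (\<lambda>p. j (F p)) g"
  shows "g \<in> range j"
proof -
  obtain h s where tails: "\<forall>p\<in>P. isGlb UNIV (F ` {r \<in> P. le p r}) (h p)"
    and s: "isLub UNIV (h ` P) s"
    using monotonically_complete_liminf[OF mc dir, of F C, OF F] by blast
  note h = tails[rule_format]
  obtain Q where Q: "decreases_to_zero Q" "\<forall>q\<in>Q. \<exists>p0\<in>P. \<forall>p\<in>P. le p0 p \<longrightarrow> \<bar>j (F p) - g\<bar> \<le> q"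
    using lim unfolding order_converges_def by blast
  have bounds: "g - j s \<le> q \<and> j s - g \<le> q" if q: "q \<in> Q" for q
  proof -
    obtain p0 where p0: "p0 \<in> P" and close: "\<forall>p\<in>P. le p0 p \<longrightarrow> \<bar>j (F p) - g\<bar> \<le> q"
      using Q(2) q by blast
    have close1: "g - q \<le> j (F p)" "j (F p) \<le> g + q" if "p \<in> P" "le p0 p" for p
    proof -
      have "\<bar>j (F p) - g\<bar> \<le> q" using close that by blast
      then show "g - q \<le> j (F p)" "j (F p) \<le> g + q"
        by (simp_all add: abs_le_iff algebra_simps)
    qed
    have "g - q \<le> j (h p0)"
      using isGlb_image[OF h[OF p0]] close1(1) unfolding isGlb_UNIV_iff by auto
    also have "j (h p0) \<le> j s" using s p0 by (auto simp: isLub_UNIV_iff)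
    finally have 1: "g - j s \<le> q" by (simp add: algebra_simps)
    have "j (h p) \<le> g + q" if p: "p \<in> P" for p
    proof -
      obtain r where r: "r \<in> P" "le p r" "le p0 r" using directed_byD[OF dir p p0] .
      have "h p \<le> F r" using h[OF p] r by (auto simp: isGlb_UNIV_iff)
      then have "j (h p) \<le> j (F r)" by simp
      also have "\<dots> \<le> g + q" using close1(2) r by blast
      finally show ?thesis .
    qed
    then have "j s \<le> g + q" using isLub_image[OF s] unfolding isLub_UNIV_iff by auto
    then show ?thesis using 1 by (simp add: algebra_simps)
  qed
  have "g - j s \<le> 0" "j s - g \<le> 0"
    by (rule decreases_to_zeroD(3)[OF Q(1)], use bounds in blast)+
  then have "g = j s" by (intro antisym) auto
  then show ?thesis by blast
qed

lemma monotonically_complete_order_adherence: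
  assumes mc: "monotonically_complete TYPE('a)"
  shows "order_adherence TYPE('i) (j ` cball 0 1) \<subseteq> range j"
proof
  fix g assume "g \<in> order_adherence TYPE('i) (j ` cball 0 1)"
  then obtain P :: "('i, 'u) net_index set" and le f where dir: "directed_by P le"
    and f: "f ` P \<subseteq> j ` cball 0 1" and lim: "order_converges P le f g"
    unfolding order_adherence_def by blast
  have "\<exists>x. f p = j x \<and> norm x \<le> 1" if "p \<in> P" for p
  proof -
    have "f p \<in> j ` cball 0 1" using f that by blast
    then show ?thesis by auto
  qed
  then have "\<forall>p\<in>P. \<exists>x. f p = j x \<and> norm x \<le> 1" by blast
  from bchoice[OF this] obtain F where F: "\<forall>p\<in>P. f p = j (F p) \<and> norm (F p) \<le> 1" ..
  have lim': "order_converges P le (\<lambda>p. j (F p)) g"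
    using lim F unfolding order_converges_def by simp
  have 1: "pprt g \<in> range j"
  proof (rule positive_order_limit_in_range[OF mc dir])
    show "order_converges P le (\<lambda>p. j (pprt (F p))) (pprt g)"
      using order_converges_pprt[OF lim'] by (simp add: j_pprt)
    show "norm (pprt (F p)) \<le> 1" if "p \<in> P" for p
      using norm_pprt_le[of "F p"] F that by (auto intro: order_trans)
  qed simp
  have 2: "pprt (- g) \<in> range j"
  proof (rule positive_order_limit_in_range[OF mc dir])
    show "order_converges P le (\<lambda>p. j (pprt (- F p))) (pprt (- g))"
      using order_converges_pprt[OF order_converges_uminus[OF lim']] by (simp add: j_pprt)
    show "norm (pprt (- F p)) \<le> 1" if "p \<in> P" for p
      using norm_pprt_le[of "- F p"] F that by (auto intro: order_trans)
  qed simp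
  obtain a b where "pprt g = j a" "pprt (- g) = j b" using 1 2 by blast
  moreover have "g = pprt g - pprt (- g)" using prts[of g] by (simp add: pprt_neg)
  ultimately have "g = j (a - b)" by simp
  then show "g \<in> range j" by blast
qed

lemma order_adherence_imp_isLub:
  assumes adh: "order_adherence TYPE('i) (j ` cball 0 1) \<subseteq> range j"
    and A: "A \<subseteq> cball 0 1 \<inter> {0..}" "directed_by A (\<le>)" "bdd_above (j ` A)"
  shows "\<exists>s. isLub UNIV A s"
proof -
  have Ane: "A \<noteq> {}" using A(2) by (auto simp: directed_by_def)
  obtain u where u: "isLub UNIV (j ` A) u"
    using universally_complete A(3) Ane unfolding universally_complete_def by (metis image_is_empty)
  have au: "j a \<le> u" if "a \<in> A" for a using u that by (auto simp: isLub_UNIV_iff)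
  have jA: "directed_by (j ` A) (\<le>)"
    using A(2) by (intro directed_by_orderI) (auto simp: directed_by_def)
  \<comment> \<open>A member of the set is its own index, stored in the right summand with the empty
    set as a placeholder.\<close>
  define \<iota> :: "'u \<Rightarrow> ('i, 'u) net_index" where "\<iota> x = Inr (x, {})" for x
  define f :: "('i, 'u) net_index \<Rightarrow> 'u" where "f p = fst (projr p)" for p
  have f\<iota>: "f (\<iota> x) = x" for x by (simp add: f_def \<iota>_def)
  \<comment> \<open>The gaps \<open>u - j a\<close> witness order convergence of the increasing net
    to its supremum.\<close>
  define Q where "Q = (\<lambda>a. u - a) ` j ` A"
  have "decreases_to_zero Q"
  proof (rule decreases_to_zeroI)
    show "Q \<noteq> {}" using Ane by (simp add: Q_def)
    fix a b assume "a \<in> Q" "b \<in> Q"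
    then obtain a' b' where ab: "a' \<in> j ` A" "b' \<in> j ` A" "a = u - a'" "b = u - b'"
      unfolding Q_def by blast
    obtain r where "r \<in> j ` A" "a' \<le> r" "b' \<le> r" using directed_byD[OF jA ab(1,2)] .
    then show "\<exists>c\<in>Q. c \<le> a \<and> c \<le> b"
      unfolding Q_def using ab(3,4) by (intro bexI[of _ "u - r"]) (auto intro: diff_left_mono)
  next
    fix l assume "\<And>q. q \<in> Q \<Longrightarrow> l \<le> q"
    then have "l \<le> u - a" if "a \<in> j ` A" for a using that unfolding Q_def by blast
    then have "\<forall>a\<in>j ` A. a \<le> u - l" by (simp add: algebra_simps)
    then have "u \<le> u - l" using u unfolding isLub_UNIV_iff by blast
    then show "l \<le> 0" by simp
  qed (use au in \<open>auto simp: Q_def\<close>)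
  moreover have "\<exists>p0\<in>\<iota> ` j ` A. \<forall>p\<in>\<iota> ` j ` A. f p0 \<le> f p \<longrightarrow> \<bar>f p - u\<bar> \<le> q" if q: "q \<in> Q" for q
  proof -
    obtain a where a: "a \<in> j ` A" "q = u - a" using q unfolding Q_def by blast
    have "\<bar>b - u\<bar> \<le> u - a" if "b \<in> j ` A" "a \<le> b" for b
    proof -
      have "b \<le> u" using that(1) au by blast
      then have "\<bar>b - u\<bar> = u - b" by (simp add: abs_of_nonpos)
      then show ?thesis using that(2) by (simp add: diff_left_mono)
    qed
    then show ?thesis using a by (intro bexI[of _ "\<iota> a"]) (auto simp: f\<iota>)
  qed
  ultimately have "order_converges (\<iota> ` j ` A) (\<lambda>p q. f p \<le> f q) f u"
    unfolding order_converges_def by blast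
  moreover have "directed_by (\<iota> ` j ` A) (\<lambda>p q. f p \<le> f q)"
    using jA f\<iota> by (rule directed_by_pullback)
  moreover have "f ` \<iota> ` j ` A \<subseteq> j ` cball 0 1" using A(1) by (auto simp: f\<iota>)
  ultimately have "u \<in> order_adherence TYPE('i) (j ` cball 0 1)"
    unfolding order_adherence_def by blast
  then obtain s where s: "u = j s" using adh by blast
  have "a \<le> s" if "a \<in> A" for a using au[OF that] s by simp
  moreover have "s \<le> b" if "\<forall>a\<in>A. a \<le> b" for b
  proof -
    have "u \<le> j b" using u that by (auto simp: isLub_UNIV_iff)
    then show ?thesis using s by simp
  qed
  ultimately show ?thesis unfolding isLub_UNIV_iff by blast
qed

text \<open>A positive \<open>g\<close> below some \<open>j e\<close> is the infimum of its
  majorants from the normed lattice. Otherwise order density gives \<open>y > 0\<close> with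
  \<open>j y\<close> below \<open>pprt (j l - g)\<close>, and every majorant can be lowered by
  \<open>y\<close>. Starting from \<open>e\<close> and repeating this contradicts the Archimedean
  property.\<close>

lemma le_of_majorants:
  assumes g: "0 \<le> g" "g \<le> j e" and l: "\<And>q. g \<le> j q \<Longrightarrow> l \<le> q"
  shows "j l \<le> g"
proof (rule ccontr)
  assume "\<not> j l \<le> g"
  then have "0 < pprt (j l - g)"
    using pprt_eq_0_iff[of "j l - g"] zero_le_pprt[of "j l - g"] by (auto simp: less_le)
  then obtain y where y: "0 < y" "j y \<le> pprt (j l - g)" by (rule order_dense_range)
  have step: "g \<le> j (q - y)" if q: "g \<le> j q" for q
  proof -
    have "j l \<le> j q" using l[OF q] by simp
    then have "pprt (j l - g) \<le> j q - g" using q by (simp add: pprt_le_iff diff_right_mono)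
    then have "j y \<le> j q - g" using y(2) by (rule order_trans[rotated])
    then show ?thesis by (simp add: algebra_simps)
  qed
  have "g \<le> j (e - real n *\<^sub>R y)" for n
  proof (induction n)
    case (Suc n)
    have "g \<le> j (e - real n *\<^sub>R y - y)" using Suc by (rule step)
    then show ?case by (simp add: scaleR_add_left algebra_simps)
  qed (simp add: g(2))
  then have "0 \<le> j (e - real n *\<^sub>R y)" for n using g(1) order_trans by blast
  then have "real n *\<^sub>R y \<le> e" for n by (simp only: j_nonneg_iff) simp
  then have "y = 0" using less_imp_le[OF y(1)] by (intro archimedean_normed_lattice)
  then show False using y(1) by simp
qed

lemma uo_complete_imp_isLub:
  assumes uo: "\<And>(P :: ('i, 'a) net_index set) le f. directed_by P le \<Longrightarrow> f ` P \<subseteq> cball 0 1 \<Longrightarrow>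
      uo_Cauchy P le f \<Longrightarrow> \<exists>g :: 'a. uo_converges P le f g"
    and A: "A \<subseteq> cball 0 1 \<inter> {0..}" "directed_by A (\<le>)" "bdd_above (j ` A)"
  shows "\<exists>s. isLub UNIV A s"
proof -
  have Ane: "A \<noteq> {}" using A(2) by (auto simp: directed_by_def)
  obtain u where u: "isLub UNIV (j ` A) u"
    using universally_complete A(3) Ane unfolding universally_complete_def by (metis image_is_empty)
  have au: "j a \<le> u" if "a \<in> A" for a using u that by (auto simp: isLub_UNIV_iff)
  define \<iota> :: "'a \<Rightarrow> ('i, 'a) net_index" where "\<iota> x = Inr (x, {})" for x
  define f :: "('i, 'a) net_index \<Rightarrow> 'a" where "f p = fst (projr p)" for p
  have f\<iota>: "f (\<iota> x) = x" for x by (simp add: f_def \<iota>_def)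
  have dir: "directed_by (\<iota> ` A) (\<lambda>p q. f p \<le> f q)"
    using A(2) f\<iota> by (rule directed_by_pullback)
  have f1: "f ` \<iota> ` A \<subseteq> cball 0 1" using A(1) by (auto simp: f\<iota>)
  have "uo_Cauchy (\<iota> ` A) (\<lambda>p q. f p \<le> f q) f"
    unfolding uo_Cauchy_iff[OF dir]
  proof (intro allI impI)
    fix e :: 'a assume e: "0 \<le> e"
    \<comment> \<open>The truncated gaps \<open>inf (u - j a) (j e)\<close> live in the universal
      completion, whereas the uo-Cauchy property asks for a set in the normed lattice. The majorants
      of the gaps serve instead, and \<open>le_of_majorants\<close> shows that their infimum is
      0.\<close>
    define Q where "Q = {q. \<exists>a\<in>A. inf (u - j a) (j e) \<le> j q}"
    have "decreases_to_zero Q"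
    proof (rule decreases_to_zeroI)
      have "e \<in> Q" using Ane by (auto simp: Q_def)
      then show "Q \<noteq> {}" by blast
      fix p q assume "p \<in> Q" "q \<in> Q"
      then obtain a b where ab: "a \<in> A" "b \<in> A" "inf (u - j a) (j e) \<le> j p" "inf (u - j b) (j e) \<le> j q"
        unfolding Q_def by blast
      obtain r where r: "r \<in> A" "a \<le> r" "b \<le> r" using directed_byD[OF A(2) ab(1,2)] .
      have "inf (u - j r) (j e) \<le> inf (u - j a) (j e)" "inf (u - j r) (j e) \<le> inf (u - j b) (j e)"
        using r(2,3) by (intro inf_mono diff_left_mono order_refl; simp)+
      then have "inf (u - j r) (j e) \<le> j (inf p q)"
        using ab(3,4) unfolding j_inf by (meson inf_greatest order_trans)
      then have "inf p q \<in> Q" using r(1) unfolding Q_def by blast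
      then show "\<exists>c\<in>Q. c \<le> p \<and> c \<le> q" by (rule bexI[rotated]) simp
    next
      fix q assume "q \<in> Q"
      then obtain a where a: "a \<in> A" "inf (u - j a) (j e) \<le> j q" unfolding Q_def by blast
      have "0 \<le> inf (u - j a) (j e)" using au[OF a(1)] e by simp
      then have "0 \<le> j q" using a(2) by (rule order_trans)
      then show "0 \<le> q" by simp
    next
      fix l assume l: "\<And>q. q \<in> Q \<Longrightarrow> l \<le> q"
      have "j a \<le> u - j l" if a: "a \<in> A" for a
      proof -
        have "j l \<le> inf (u - j a) (j e)"
        proof (rule le_of_majorants)
          show "0 \<le> inf (u - j a) (j e)" using au[OF a] e by simp
          show "inf (u - j a) (j e) \<le> j e" by simp
          show "l \<le> q" if "inf (u - j a) (j e) \<le> j q" for q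
            using that a by (intro l) (auto simp: Q_def)
        qed
        then have "j l \<le> u - j a" by simp
        then show ?thesis by (simp add: algebra_simps)
      qed
      then have "u \<le> u - j l" using u unfolding isLub_UNIV_iff by blast
      then show "l \<le> 0" by simp
    qed
    moreover have "\<exists>p0\<in>\<iota> ` A. \<forall>p\<in>\<iota> ` A. \<forall>r\<in>\<iota> ` A. f p0 \<le> f p \<longrightarrow> f p0 \<le> f r \<longrightarrow> inf \<bar>f p - f r\<bar> e \<le> q"
      if q: "q \<in> Q" for q
    proof -
      obtain a where a: "a \<in> A" "inf (u - j a) (j e) \<le> j q" using q unfolding Q_def by blast
      \<comment> \<open>Beyond \<open>a\<close>, all members lie between \<open>j a\<close> and
        \<open>u\<close>, so any two of them differ by at most the gap
        \<open>u - j a\<close>.\<close>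
      have diff: "j b - j c \<le> u - j a" if "b \<in> A" "a \<le> c" for b c
        using au[OF that(1)] that(2) by (intro diff_mono) auto
      have "inf \<bar>b - c\<bar> e \<le> q" if bc: "b \<in> A" "c \<in> A" "a \<le> b" "a \<le> c" for b c
      proof -
        have "\<bar>j b - j c\<bar> \<le> u - j a"
          using diff[OF bc(1,4)] diff[OF bc(2,3)] by (intro abs_leI) auto
        then have "inf \<bar>j b - j c\<bar> (j e) \<le> inf (u - j a) (j e)" by (intro inf_mono) auto
        also note a(2)
        finally have "j (inf \<bar>b - c\<bar> e) \<le> j q"
          by (simp only: j_inf j_abs j_simps)
        then show ?thesis by simp
      qed
      then show ?thesis using a(1) by (intro bexI[of _ "\<iota> a"]) (auto simp: f\<iota>)
    qed
    ultimately show "\<exists>Q. decreases_to_zero Q \<and> (\<forall>q\<in>Q. \<exists>p0\<in>\<iota> ` A. \<forall>p\<in>\<iota> ` A. \<forall>r\<in>\<iota> ` A.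
        f p0 \<le> f p \<longrightarrow> f p0 \<le> f r \<longrightarrow> inf \<bar>f p - f r\<bar> e \<le> q)"
      by blast
  qed
  then obtain s where "uo_converges (\<iota> ` A) (\<lambda>p q. f p \<le> f q) f s"
    using uo[OF dir f1] by blast
  then have "isLub UNIV (f ` \<iota> ` A) s" using isLub_of_uo_limit[OF dir] by blast
  then show ?thesis by (auto simp: image_image f\<iota>)
qed

end

section \<open>Equivalence of the five completeness conditions\<close>

theorem theorem5p5:
  fixes j :: "'a::normed_lattice \<Rightarrow> 'u::vector_lattice"
  assumes "universal_completion j"
  shows
    "(monotonically_complete TYPE('a) \<longleftrightarrow>
        (\<forall>A::'a set. directed_by A (\<le>) \<longrightarrow> bounded A \<longrightarrow> dominable j A \<longrightarrow> (\<exists>s. isLub UNIV A s)))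
   \<and> (monotonically_complete TYPE('a) \<longleftrightarrow>
        complete (UNIV :: 'a set) \<and>
        (\<forall>D::'a set. D \<noteq> {} \<longrightarrow> D \<subseteq> {0..} \<longrightarrow> disjoint_set D \<longrightarrow> finite_sups D \<subseteq> cball 0 1 \<longrightarrow>
           (\<exists>s. isLub UNIV D s)))
   \<and> (monotonically_complete TYPE('a) \<longleftrightarrow>
        order_adherence TYPE('i) (j ` cball 0 1) \<subseteq> range j)
   \<and> (monotonically_complete TYPE('a) \<longleftrightarrow>
        (\<forall>(P :: ('i, 'a) net_index set) le (f :: ('i, 'a) net_index \<Rightarrow> 'a).
           directed_by P le \<longrightarrow> f ` P \<subseteq> cball 0 1 \<longrightarrow> uo_Cauchy P le f \<longrightarrow>
           (\<exists>g. uo_converges P le f g)))"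
proof -
  interpret universal_completion_embedding j by standard (rule assms)
  show ?thesis
    unfolding disjointly_complete_def[of "TYPE('a)", symmetric]
  proof (intro conjI iffI allI impI)
    fix A :: "'a set"
    assume "monotonically_complete TYPE('a)" "directed_by A (\<le>)" "bounded A"
    then show "\<exists>s. isLub UNIV A s" by (rule monotonically_complete_ex_lub)
  next
    assume *: "\<forall>A::'a set. directed_by A (\<le>) \<longrightarrow> bounded A \<longrightarrow> dominable j A \<longrightarrow> (\<exists>s. isLub UNIV A s)"
    show "monotonically_complete TYPE('a)"
    proof (rule monotonically_completeI)
      fix A :: "'a set"
      assume A: "A \<subseteq> cball 0 1 \<inter> {0..}" "directed_by A (\<le>)" "bdd_above (j ` A)"
      have "bounded A" by (rule bounded_subset[OF bounded_cball[of 0 1]]) (use A(1) in blast)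
      moreover have "dominable j A"
        using A(1,3) unfolding dominable_def by (auto intro!: bdd_belowI[of _ 0])
      ultimately show "\<exists>s. isLub UNIV A s" using * A(2) by blast
    qed
  next
    assume "complete (UNIV :: 'a set) \<and> disjointly_complete TYPE('a)"
    then show "monotonically_complete TYPE('a)"
      by (intro monotonically_completeI disjointly_complete_imp_isLub) auto
  next
    assume "order_adherence TYPE('i) (j ` cball 0 1) \<subseteq> range j"
    then show "monotonically_complete TYPE('a)"
      by (intro monotonically_completeI order_adherence_imp_isLub)
  next
    assume "\<forall>(P :: ('i, 'a) net_index set) le (f :: ('i, 'a) net_index \<Rightarrow> 'a).
           directed_by P le \<longrightarrow> f ` P \<subseteq> cball 0 1 \<longrightarrow> uo_Cauchy P le f \<longrightarrow>
           (\<exists>g. uo_converges P le f g)"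
    then show "monotonically_complete TYPE('a)"
      by (intro monotonically_completeI uo_complete_imp_isLub) blast+
  qed (simp_all add: monotonically_complete_imp_complete monotonically_complete_imp_disjointly_complete
      monotonically_complete_order_adherence monotonically_complete_uo_Cauchy)
qed

end
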